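(* For each $k\ge 1$ let $p_{0k},p_{1k}\ge 0$ with $p_{0k}+p_{1k}=1$, and let $\psi_1,\psi_2,\dots$ be independent random variables such that $\psi_k$ takes the value $0$ with probability $p_{0k}$ and the value $1$ with probability $p_{1k}$. For $\lambda\in(0,1)$ let $\psi=\sum_{k=1}^{\infty}\psi_k\lambda^k$. If $$\sum_{k=1}^{\infty}\left(\tfrac12-p_{0k}\right)^2<\infty,$$ then for almost all $\lambda\in[\tfrac12,1)$ (with respect to Lebesgue measure) the random variable $\psi$ has an absolutely continuous distribution.
   Context: A random variable has an absolutely continuous distribution if its distribution is absolutely continuous with respect to Lebesgue measure on $\mathbb{R}$. *)

theory Defs
  imports "HOL-Probability.Probability"
begin

text \<open>Measurability is required explicitly because \<^const>\<open>distr\<close> carries no information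
  about the law of a function that is not measurable.\<close>

definition has_ac_distribution :: "'a measure \<Rightarrow> ('a \<Rightarrow> real) \<Rightarrow> bool" where
  "has_ac_distribution M X \<longleftrightarrow>
     X \<in> borel_measurable M \<and> absolutely_continuous lborel (distr M borel X)"

text \<open>The random variable $\sum_{k \geq 1} \psi_k r^k$; the value \<open>\<psi> 0\<close> is never used.\<close>

definition power_series_rv :: "(nat \<Rightarrow> 'a \<Rightarrow> real) \<Rightarrow> real \<Rightarrow> 'a \<Rightarrow> real" where
  "power_series_rv \<psi> r \<omega> = (\<Sum>k. \<psi> (Suc k) \<omega> * r ^ Suc k)"

end

theory Submission
  imports Defs
begin

text \<open>
  The energy method of Peres and Solomyak. Two independent copies of the digit sequence agree on the
  first \<open>n\<close> places with probability \<open>\<Prod>k\<le>n. (p0 k)\<^sup>2 + (p1 k)\<^sup>2 = \<Prod>k\<le>n. 1/2 + 2 * (1/2 - p0 k)\<^sup>2\<close>,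
  which is at most a constant times \<open>2 ^ (-n)\<close>; so the biased case needs no comparison with the
  fair one. The difference of the two copies is, up to sign, \<open>r ^ n * g r\<close> with \<open>g\<close> a power series
  with constant term 1 and coefficients in \<open>{-1, 0, 1}\<close>. Transversality says that \<open>r\<close> spends
  measure \<open>O(\<rho>)\<close> in \<open>{\<bar>g\<bar> \<le> \<rho>}\<close>. Integrating over \<open>r\<close> and applying Fatou gives, for almost all \<open>r\<close>, a
  sequence \<open>\<rho> \<rightarrow> 0\<close> along which the two copies are within \<open>\<rho>\<close> of each other with probability \<open>O(\<rho>)\<close>,
  and this forces the law to be absolutely continuous.

  Transversality is available for \<open>r \<le> 0.64\<close>, and for \<open>r \<le> 0.708\<close> if every third digit is
  deleted; the latter is enough for \<open>r > 2 powr (-2/3)\<close>. Both together cover \<open>(1/2, 1/sqrt 2]\<close>.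
  For other \<open>r\<close> one looks only at digits whose index is a multiple of \<open>m\<close>, where \<open>r ^ m\<close> lies in
  that interval. The deleted digits contribute an independent summand, which preserves
  absolute continuity.
\<close>

subsection \<open>Transversality\<close>

text \<open>Cauchy's mean value theorem for \<open>t powr (i - \<kappa>)\<close> against
  \<open>t powr (-\<kappa>)\<close>: the quotient of the derivatives is
  \<open>- (i - \<kappa>) / \<kappa> * c ^ i\<close> with \<open>c \<le> x\<close>. Each term is
  thus compared with the constant term, and no series has to be differentiated.\<close>

lemma powr_diff_bound:
  fixes r s x \<kappa> :: real and i :: nat
  assumes "0 < r" "r \<le> s" "s \<le> x" "\<kappa> > 0"
  shows "\<bar>s powr (i - \<kappa>) - r powr (i - \<kappa>)\<bar> * \<kappa> \<le> \<bar>i - \<kappa>\<bar> * x ^ i * (r powr (-\<kappa>) - s powr (-\<kappa>))"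
proof (cases "r = s")
  case False
  then have rs: "r < s" using assms by simp
  have "\<exists>c>r. c < s \<and> (s powr (i - \<kappa>) - r powr (i - \<kappa>)) * (- \<kappa> * c powr (- \<kappa> - 1))
      = (s powr (-\<kappa>) - r powr (-\<kappa>)) * ((i - \<kappa>) * c powr (i - \<kappa> - 1))"
  proof (rule GMVT')
    show "isCont (\<lambda>t. t powr (real i - \<kappa>)) z" if "r \<le> z" "z \<le> s" for z
      using that assms by (intro continuous_intros) auto
    show "isCont (\<lambda>t. t powr (- \<kappa>)) z" if "r \<le> z" "z \<le> s" for z
      using that assms by (intro continuous_intros) auto
    show "((\<lambda>t. t powr (real i - \<kappa>)) has_real_derivative (i - \<kappa>) * z powr (i - \<kappa> - 1)) (at z)"
      if "r < z" "z < s" for z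
      using that assms by (intro has_real_derivative_powr) auto
    show "((\<lambda>t. t powr (- \<kappa>)) has_real_derivative - \<kappa> * z powr (- \<kappa> - 1)) (at z)"
      if "r < z" "z < s" for z
      using that assms by (intro has_real_derivative_powr) auto
  qed (use rs in auto)
  then obtain c where c: "r < c" "c < s" and
    eq: "(s powr (i - \<kappa>) - r powr (i - \<kappa>)) * (- \<kappa> * c powr (- \<kappa> - 1))
      = (s powr (-\<kappa>) - r powr (-\<kappa>)) * ((i - \<kappa>) * c powr (i - \<kappa> - 1))"
    by blast
  have c0: "c > 0" using c assms by simp
  have "c powr (i - \<kappa> - 1) = c ^ i * c powr (- \<kappa> - 1)"
    using c0 by (simp add: powr_realpow[symmetric] powr_add[symmetric] algebra_simps)
  then have "((s powr (i - \<kappa>) - r powr (i - \<kappa>)) * \<kappa>) * c powr (- \<kappa> - 1)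
      = ((r powr (-\<kappa>) - s powr (-\<kappa>)) * ((i - \<kappa>) * c ^ i)) * c powr (- \<kappa> - 1)"
    using eq by (simp add: algebra_simps)
  then have e2: "(s powr (i - \<kappa>) - r powr (i - \<kappa>)) * \<kappa> = (r powr (-\<kappa>) - s powr (-\<kappa>)) * ((i - \<kappa>) * c ^ i)"
    using c0 by simp
  have nn: "r powr (-\<kappa>) - s powr (-\<kappa>) \<ge> 0"
    using assms by (simp add: powr_mono2')
  have "\<bar>s powr (i - \<kappa>) - r powr (i - \<kappa>)\<bar> * \<kappa> = \<bar>(r powr (-\<kappa>) - s powr (-\<kappa>)) * ((i - \<kappa>) * c ^ i)\<bar>"
    using e2 \<open>\<kappa> > 0\<close> by (metis abs_mult abs_of_pos)
  also have "\<dots> = \<bar>i - \<kappa>\<bar> * c ^ i * (r powr (-\<kappa>) - s powr (-\<kappa>))"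
    using nn c0 by (simp add: abs_mult)
  also have "\<dots> \<le> \<bar>i - \<kappa>\<bar> * x ^ i * (r powr (-\<kappa>) - s powr (-\<kappa>))"
    using nn c0 c assms by (intro mult_right_mono mult_left_mono power_mono) auto
  finally show ?thesis .
qed simp

lemma powr_minus_diff_ge:
  fixes r s \<kappa> :: real
  assumes "0 < r" "r \<le> s" "s \<le> 1" "\<kappa> > 0"
  shows "\<kappa> * (s - r) \<le> r powr (-\<kappa>) - s powr (-\<kappa>)"
proof (cases "r = s")
  case False
  then have rs: "r < s" using assms by simp
  have "\<exists>c. r < c \<and> c < s \<and> s powr (-\<kappa>) - r powr (-\<kappa>) = (s - r) * (- \<kappa> * c powr (- \<kappa> - 1))"
    using rs assms by (intro MVT2 has_real_derivative_powr) auto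
  then obtain c where c: "r < c" "c < s" "s powr (-\<kappa>) - r powr (-\<kappa>) = (s - r) * (- \<kappa> * c powr (- \<kappa> - 1))"
    by blast
  have "1 \<le> c powr (-\<kappa> - 1)"
    using c assms powr_mono2'[of "-\<kappa> - 1" c 1] by simp
  then have "(s - r) * \<kappa> * 1 \<le> (s - r) * \<kappa> * c powr (-\<kappa> - 1)"
    using assms by (intro mult_left_mono) auto
  then show ?thesis using c(3) by (simp add: algebra_simps)
qed simp

lemma summable_bounded_coeff_power:
  fixes b :: "nat \<Rightarrow> real"
  assumes "\<And>i. \<bar>b i\<bar> \<le> 1" "0 \<le> y" "y < 1"
  shows "summable (\<lambda>i. b i * y ^ i)"
  using assms
  by (intro summable_comparison_test[OF _ summable_geometric[of y]] exI[of _ 0])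
     (auto simp: abs_mult intro!: mult_left_le_one_le)

text \<open>The derivative of \<open>t powr (-\<kappa>) * (1 + \<Sum>i\<ge>1. b i * t ^ i)\<close> is
  \<open>t powr (-\<kappa> - 1) * (-\<kappa> + \<Sum>i\<ge>1. (i - \<kappa>) * b i * t ^ i)\<close>, which is negative
  as soon as the weights \<open>v\<close> sum to less than \<open>\<kappa>\<close>. This is dual to exhibiting
  a star-function in the sense of Peres and Solomyak.\<close>

lemma powr_times_series_decreasing:
  fixes b v :: "nat \<Rightarrow> real"
  assumes b0: "b 0 = 1" and b1: "\<And>i. \<bar>b i\<bar> \<le> 1"
    and v0: "\<And>i. v i \<ge> 0" and v: "\<And>i. i \<ge> 1 \<Longrightarrow> b i \<noteq> 0 \<Longrightarrow> \<bar>i - \<kappa>\<bar> * x ^ i \<le> v i"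
    and sv: "summable v" "suminf v \<le> \<kappa> - \<eta>"
    and "\<kappa> > 0" "\<eta> > 0" "0 < r" "r \<le> s" "s \<le> x" "x < 1"
  shows "\<eta> * (s - r) \<le> r powr (-\<kappa>) * (\<Sum>i. b i * r ^ i) - s powr (-\<kappa>) * (\<Sum>i. b i * s ^ i)"
proof -
  define d where "d = r powr (-\<kappa>) - s powr (-\<kappa>)"
  have d: "\<kappa> * (s - r) \<le> d" unfolding d_def using assms by (intro powr_minus_diff_ge) auto
  have d0: "d \<ge> 0" unfolding d_def using assms by (simp add: powr_mono2')
  define h where "h t i = t powr (-\<kappa>) * (b i * t ^ i)" for t i
  have hpow: "h t i = b i * t powr (i - \<kappa>)" if "t > 0" for t i
    using that by (simp add: h_def powr_realpow[symmetric] powr_add[symmetric] algebra_simps)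
  have sh: "summable (h t)" if "0 \<le> t" "t < 1" for t
    unfolding h_def using that b1 by (intro summable_mult summable_bounded_coeff_power) auto
  have hs: "suminf (h t) = t powr (-\<kappa>) * (\<Sum>i. b i * t ^ i)" if "0 \<le> t" "t < 1" for t
    unfolding h_def using that b1 by (intro suminf_mult summable_bounded_coeff_power) auto
  define u where "u i = h r i - h s i" for i
  have su: "summable u" unfolding u_def using sh assms by (intro summable_diff) auto
  have u0: "u 0 = d" by (simp add: u_def h_def b0 d_def)
  \<comment> \<open>Of the decrease \<open>d\<close> of the constant term, the later terms can undo
    at most the fraction \<open>(\<kappa> - \<eta>) / \<kappa>\<close>; what remains,
    \<open>\<eta> * (d / \<kappa>)\<close>, is at least \<open>\<eta> * (s - r)\<close>.\<close>
  have ui: "\<bar>u (Suc i)\<bar> \<le> v (Suc i) * (d / \<kappa>)" for i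
  proof (cases "b (Suc i) = 0")
    case False
    have "\<bar>u (Suc i)\<bar> * \<kappa> = \<bar>b (Suc i)\<bar> * (\<bar>s powr (Suc i - \<kappa>) - r powr (Suc i - \<kappa>)\<bar> * \<kappa>)"
      using assms by (simp add: u_def hpow abs_mult right_diff_distrib[symmetric] abs_minus_commute)
    also have "\<dots> \<le> 1 * (\<bar>Suc i - \<kappa>\<bar> * x ^ Suc i * d)"
      unfolding d_def using assms by (intro mult_mono b1 powr_diff_bound) auto
    also have "\<dots> \<le> v (Suc i) * d"
      using v[of "Suc i"] False d0 by (auto intro: mult_right_mono)
    finally show ?thesis using \<open>\<kappa> > 0\<close> by (simp add: field_simps)
  qed (use v0 d0 \<open>\<kappa> > 0\<close> in \<open>simp add: u_def h_def\<close>)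
  have svS: "summable (\<lambda>i. v (Suc i))" using sv by (simp add: summable_Suc_iff)
  have "(\<Sum>i. v (Suc i)) \<le> \<kappa> - \<eta>"
    using suminf_split_head[OF sv(1)] sv(2) v0[of 0] by simp
  then have V: "(\<Sum>i. v (Suc i)) * (d / \<kappa>) \<le> (\<kappa> - \<eta>) * (d / \<kappa>)"
    using d0 \<open>\<kappa> > 0\<close> by (intro mult_right_mono) auto
  have "- ((\<Sum>i. v (Suc i)) * (d / \<kappa>)) = (\<Sum>i. - (v (Suc i) * (d / \<kappa>)))"
    by (simp only: suminf_mult2[OF svS] suminf_minus[OF summable_mult2[OF svS]])
  also have "\<dots> \<le> (\<Sum>i. u (Suc i))"
  proof (rule suminf_le)
    show "- (v (Suc i) * (d / \<kappa>)) \<le> u (Suc i)" for i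
      using ui[of i] by (simp only: abs_le_iff) linarith
    show "summable (\<lambda>i. - (v (Suc i) * (d / \<kappa>)))"
      by (intro summable_minus summable_mult2 svS)
    show "summable (\<lambda>i. u (Suc i))"
      using su by (simp only: summable_Suc_iff)
  qed
  finally have "d - (\<kappa> - \<eta>) * (d / \<kappa>) \<le> suminf u"
    using V suminf_split_head[OF su] u0 by simp
  also have "d - (\<kappa> - \<eta>) * (d / \<kappa>) = \<eta> * (d / \<kappa>)" using \<open>\<kappa> > 0\<close> by (simp add: field_simps)
  finally have "\<eta> * (d / \<kappa>) \<le> suminf u" .
  moreover have "\<eta> * (s - r) \<le> \<eta> * (d / \<kappa>)"
    using d \<open>\<kappa> > 0\<close> \<open>\<eta> > 0\<close> by (intro mult_left_mono) (auto simp: field_simps)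
  moreover have "suminf u = suminf (h r) - suminf (h s)"
    unfolding u_def using sh assms by (intro suminf_diff[symmetric]) auto
  ultimately show ?thesis using hs[of r] hs[of s] assms by simp
qed

text \<open>Division by the leading term \<open>d n * t ^ n\<close> makes the constant term 1 and
  turns the bound \<open>\<rho>\<close> into \<open>\<rho> / a ^ n\<close>. Multiplied by
  \<open>t powr (-\<kappa>)\<close>, the quotient decreases at rate at least \<open>\<eta>\<close>,
  so it is small at both \<open>r\<close> and \<open>s\<close> only if these are close.\<close>

lemma series_sublevel_diameter:
  fixes d v :: "nat \<Rightarrow> real"
  assumes dn: "\<And>k. k < n \<Longrightarrow> d k = 0" "\<bar>d n\<bar> = 1" and d1: "\<And>i. \<bar>d i\<bar> \<le> 1"
    and v0: "\<And>i. v i \<ge> 0" and v: "\<And>i. i \<ge> 1 \<Longrightarrow> d (n + i) \<noteq> 0 \<Longrightarrow> \<bar>i - \<kappa>\<bar> * x ^ i \<le> v i"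
    and sv: "summable v" "suminf v \<le> \<kappa> - \<eta>"
    and pos: "\<kappa> > 0" "\<eta> > 0" "0 < a" "a \<le> r" "r \<le> s" "s \<le> x" "x < 1"
    and R: "\<bar>\<Sum>i. d i * r ^ i\<bar> \<le> \<rho>" and S: "\<bar>\<Sum>i. d i * s ^ i\<bar> \<le> \<rho>"
  shows "s - r \<le> 2 * a powr (-\<kappa>) / \<eta> * \<rho> / a ^ n"
proof -
  \<comment> \<open>As \<open>d n\<close> is 1 or -1, multiplying by it is dividing by it, so
    \<open>b 0 = 1\<close>.\<close>
  define b where "b i = d n * d (n + i)" for i
  have dd: "d n * d n = 1" using dn(2) by (metis abs_mult_self_eq mult_1)
  have b1: "\<bar>b i\<bar> \<le> 1" for i using d1 dn(2) by (simp add: b_def abs_mult)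
  have D: "\<bar>\<Sum>i. b i * t ^ i\<bar> \<le> \<rho> / a ^ n" if "a \<le> t" "t \<le> x" "\<bar>\<Sum>i. d i * t ^ i\<bar> \<le> \<rho>" for t
  proof -
    have t: "0 < t" "t < 1" using that pos by auto
    have sm: "summable (\<lambda>i. d i * t ^ i)"
      using t d1 by (intro summable_bounded_coeff_power) auto
    have "(\<Sum>i. d i * t ^ i) = (\<Sum>i. d (i + n) * t ^ (i + n))"
      using suminf_split_initial_segment[OF sm, of n] dn(1) by simp
    also have "\<dots> = (\<Sum>i. d n * t ^ n * (b i * t ^ i))"
    proof (rule suminf_cong)
      fix i
      have "d n * t ^ n * (b i * t ^ i) = (d n * d n) * d (n + i) * t ^ n * t ^ i"
        unfolding b_def by (simp only: mult_ac)
      then show "d (i + n) * t ^ (i + n) = d n * t ^ n * (b i * t ^ i)"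
        by (auto simp: dd power_add add.commute)
    qed
    also have "\<dots> = d n * t ^ n * (\<Sum>i. b i * t ^ i)"
      using t b1 by (intro suminf_mult summable_bounded_coeff_power) auto
    finally have "t ^ n * \<bar>\<Sum>i. b i * t ^ i\<bar> \<le> \<rho>"
      using that(3) t by (simp add: abs_mult dn(2))
    moreover have "a ^ n * \<bar>\<Sum>i. b i * t ^ i\<bar> \<le> t ^ n * \<bar>\<Sum>i. b i * t ^ i\<bar>"
      using that pos by (intro mult_right_mono power_mono) auto
    ultimately show ?thesis using pos by (simp add: field_simps)
  qed
  have G: "\<bar>t powr (-\<kappa>) * (\<Sum>i. b i * t ^ i)\<bar> \<le> a powr (-\<kappa>) * (\<rho> / a ^ n)"
    if "a \<le> t" "t \<le> x" "\<bar>\<Sum>i. d i * t ^ i\<bar> \<le> \<rho>" for t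
    unfolding abs_mult using that pos D[OF that]
    by (intro mult_mono) (auto simp: powr_mono2')
  have "\<eta> * (s - r) \<le> r powr (-\<kappa>) * (\<Sum>i. b i * r ^ i) - s powr (-\<kappa>) * (\<Sum>i. b i * s ^ i)"
  proof (rule powr_times_series_decreasing)
    show "\<bar>i - \<kappa>\<bar> * x ^ i \<le> v i" if "i \<ge> 1" "b i \<noteq> 0" for i
      using v[of i] that by (auto simp: b_def)
  qed (use assms b1 in \<open>auto simp: b_def dd\<close>)
  also have "\<dots> \<le> 2 * (a powr (-\<kappa>) * (\<rho> / a ^ n))"
    using G[of r, OF _ _ R] G[of s, OF _ _ S] pos by linarith
  finally show ?thesis using pos by (simp add: field_simps)
qed

subsection \<open>Finite energy implies absolute continuity\<close>

lemma nn_integral_if_eq_emeasure: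
  assumes "{x \<in> space M. P x} \<in> sets M"
  shows "(\<integral>\<^sup>+x. (if P x then 1 else 0) \<partial>M) = emeasure M {x \<in> space M. P x}"
proof -
  have "(\<integral>\<^sup>+x. (if P x then 1 else 0) \<partial>M) = (\<integral>\<^sup>+x. indicator {x \<in> space M. P x} x \<partial>M)"
    by (intro nn_integral_cong) auto
  also have "\<dots> = emeasure M {x \<in> space M. P x}" by (rule nn_integral_indicator[OF assms])
  finally show ?thesis .
qed

text \<open>Smooth the law of \<open>Y\<close> at scale \<open>\<rho> k\<close>: Fatou bounds the mass of an open set by that of the smoothed
  laws, whose densities have squared norm at most \<open>L\<close>; the parameter \<open>t\<close> comes from replacing
  Cauchy-Schwarz by \<open>u * f \<le> t / 2 * f\<^sup>2 + u / (2 * t)\<close> for \<open>u\<close> in \<open>{0, 1}\<close>.\<close>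

lemma (in prob_space) emeasure_open_le_energy:
  fixes Y :: "'a \<Rightarrow> real"
  assumes Y[measurable]: "Y \<in> borel_measurable M"
    and \<rho>: "\<And>k. \<rho> k > 0" "\<rho> \<longlonglongrightarrow> 0"
    and Q: "\<And>k. emeasure (M \<Otimes>\<^sub>M M) {p \<in> space (M \<Otimes>\<^sub>M M). \<bar>Y (fst p) - Y (snd p)\<bar> \<le> \<rho> k} \<le> ennreal (L * \<rho> k)"
    and L: "L \<ge> 0" and U: "open U" and t: "t > 0"
  shows "emeasure M {\<omega> \<in> space M. Y \<omega> \<in> U} \<le> ennreal (t / 2 * L) + ennreal (1 / (2 * t)) * emeasure lborel U"
proof -
  interpret P: pair_prob_space M M ..
  interpret L1: pair_sigma_finite M lborel ..
  have [measurable]: "U \<in> sets borel" using U by simp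
  \<comment> \<open>The window of width \<open>\<rho> k\<close> centred at
    \<open>Y \<omega>\<close>; \<open>F k x / \<rho> k\<close> below is the density of the smoothed
    law.\<close>
  define c where "c k \<omega> x = (indicator {Y \<omega> - \<rho> k / 2 .. Y \<omega> + \<rho> k / 2} x :: ennreal)" for k \<omega> x
  have c_alt: "c k = (\<lambda>\<omega> x. if Y \<omega> - \<rho> k / 2 \<le> x \<and> x \<le> Y \<omega> + \<rho> k / 2 then 1 else 0)" for k
    by (auto simp: c_def fun_eq_iff)
  have cm[measurable]: "(\<lambda>p. c k (fst p) (snd p)) \<in> borel_measurable (M \<Otimes>\<^sub>M lborel)" for k
    unfolding c_alt by measurable
  define F where "F k x = (\<integral>\<^sup>+\<omega>. c k \<omega> x \<partial>M)" for k x
  have Fm[measurable]: "F k \<in> borel_measurable borel" for k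
    unfolding F_def c_alt by measurable
  have F1: "F k x \<le> 1" for k x
  proof -
    have "F k x \<le> (\<integral>\<^sup>+\<omega>. 1 \<partial>M)"
      unfolding F_def c_def by (intro nn_integral_mono) (auto split: split_indicator)
    then show ?thesis by (simp add: emeasure_space_1)
  qed
  \<comment> \<open>For \<open>Y \<omega>\<close> in the open set \<open>U\<close>, small windows
    lie inside \<open>U\<close>, and the average is eventually exactly 1.\<close>
  have ev: "indicator U (Y \<omega>) \<le> liminf (\<lambda>k. \<integral>\<^sup>+x. indicator U x * c k \<omega> x * ennreal (1 / \<rho> k) \<partial>lborel)" for \<omega>
  proof (cases "Y \<omega> \<in> U")
    case True
    then obtain e where e: "e > 0" "ball (Y \<omega>) e \<subseteq> U" using U openE by blast
    have "\<forall>\<^sub>F k in sequentially. \<rho> k < e" using \<rho>(2) e(1) by (rule order_tendstoD)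
    then have "\<forall>\<^sub>F k in sequentially. 1 \<le> (\<integral>\<^sup>+x. indicator U x * c k \<omega> x * ennreal (1 / \<rho> k) \<partial>lborel)"
    proof eventually_elim
      case (elim k)
      have "(\<integral>\<^sup>+x. indicator U x * c k \<omega> x * ennreal (1 / \<rho> k) \<partial>lborel)
          = (\<integral>\<^sup>+x. ennreal (1 / \<rho> k) * indicator {Y \<omega> - \<rho> k / 2 .. Y \<omega> + \<rho> k / 2} x \<partial>lborel)"
      proof (intro nn_integral_cong)
        fix x
        have "x \<in> {Y \<omega> - \<rho> k / 2 .. Y \<omega> + \<rho> k / 2} \<Longrightarrow> x \<in> U"
          using e elim \<rho>(1)[of k] by (auto simp: subset_iff dist_real_def)
        then show "indicator U x * c k \<omega> x * ennreal (1 / \<rho> k)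
            = ennreal (1 / \<rho> k) * indicator {Y \<omega> - \<rho> k / 2 .. Y \<omega> + \<rho> k / 2} x"
          by (auto simp: c_def split: split_indicator)
      qed
      also have "\<dots> = ennreal (1 / \<rho> k) * ennreal (\<rho> k)"
        using \<rho>(1)[of k] by (simp add: nn_integral_cmult_indicator)
      also have "\<dots> = 1"
        using \<rho>(1)[of k] by (simp add: ennreal_mult[symmetric])
      finally show ?case by simp
    qed
    then show ?thesis using True by (auto intro!: Liminf_bounded)
  qed simp
  have "emeasure M {\<omega> \<in> space M. Y \<omega> \<in> U} = (\<integral>\<^sup>+\<omega>. indicator U (Y \<omega>) \<partial>M)"
    by (subst nn_integral_if_eq_emeasure[symmetric]) (auto simp: indicator_def of_bool_def)
  also have "\<dots> \<le> (\<integral>\<^sup>+\<omega>. liminf (\<lambda>k. \<integral>\<^sup>+x. indicator U x * c k \<omega> x * ennreal (1 / \<rho> k) \<partial>lborel) \<partial>M)"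
    by (intro nn_integral_mono ev)
  also have "\<dots> \<le> liminf (\<lambda>k. \<integral>\<^sup>+\<omega>. \<integral>\<^sup>+x. indicator U x * c k \<omega> x * ennreal (1 / \<rho> k) \<partial>lborel \<partial>M)"
    unfolding c_alt by (intro nn_integral_liminf) measurable
  also have "\<dots> \<le> limsup (\<lambda>k. \<integral>\<^sup>+\<omega>. \<integral>\<^sup>+x. indicator U x * c k \<omega> x * ennreal (1 / \<rho> k) \<partial>lborel \<partial>M)"
    by (intro Liminf_le_Limsup) simp
  also have "\<dots> \<le> ennreal (t / 2 * L) + ennreal (1 / (2 * t)) * emeasure lborel U"
  proof (intro Limsup_bounded always_eventually allI)
    fix k
    have "(\<integral>\<^sup>+\<omega>. \<integral>\<^sup>+x. indicator U x * c k \<omega> x * ennreal (1 / \<rho> k) \<partial>lborel \<partial>M)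
        = (\<integral>\<^sup>+x. \<integral>\<^sup>+\<omega>. indicator U x * c k \<omega> x * ennreal (1 / \<rho> k) \<partial>M \<partial>lborel)"
      unfolding c_alt by (intro L1.Fubini'[symmetric]) measurable
    also have "\<dots> = (\<integral>\<^sup>+x. indicator U x * F k x * ennreal (1 / \<rho> k) \<partial>lborel)"
      unfolding F_def c_alt by (simp add: nn_integral_cmult nn_integral_multc)
    also have "\<dots> \<le> (\<integral>\<^sup>+x. ennreal (t / (2 * (\<rho> k)\<^sup>2)) * (F k x * F k x) + ennreal (1 / (2 * t)) * indicator U x \<partial>lborel)"
    proof (intro nn_integral_mono)
      fix x
      obtain f where f: "F k x = ennreal f" "f \<ge> 0"
        using F1[of k x] by (cases "F k x") (auto simp: top_unique)
      have "0 \<le> (t * (f / \<rho> k) - 1)\<^sup>2" by simp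
      then have "2 * t * (f / \<rho> k) \<le> t\<^sup>2 * (f / \<rho> k)\<^sup>2 + 1"
        by (simp add: power2_eq_square algebra_simps)
      then have "f / \<rho> k \<le> t / (2 * (\<rho> k)\<^sup>2) * (f * f) + 1 / (2 * t)"
        using t \<rho>(1)[of k] by (simp add: field_simps power2_eq_square)
      then show "indicator U x * F k x * ennreal (1 / \<rho> k) \<le> ennreal (t / (2 * (\<rho> k)\<^sup>2)) * (F k x * F k x) + ennreal (1 / (2 * t)) * indicator U x"
        using f t \<rho>(1)[of k]
        by (auto simp: ennreal_mult[symmetric] ennreal_plus[symmetric] simp del: ennreal_plus split: split_indicator)
    qed
    also have "\<dots> = ennreal (t / (2 * (\<rho> k)\<^sup>2)) * (\<integral>\<^sup>+x. F k x * F k x \<partial>lborel) + ennreal (1 / (2 * t)) * emeasure lborel U"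
      by (simp add: nn_integral_add nn_integral_cmult)
    \<comment> \<open>By Fubini this is the mean overlap of the windows of two independent copies.
      They meet only if their centres are within \<open>\<rho> k\<close>, and then overlap in length
      at most \<open>\<rho> k\<close>.\<close>
    also have "(\<integral>\<^sup>+x. F k x * F k x \<partial>lborel) \<le> ennreal (\<rho> k) * ennreal (L * \<rho> k)"
    proof -
      interpret L2: pair_sigma_finite "M \<Otimes>\<^sub>M M" lborel ..
      have "(\<integral>\<^sup>+x. F k x * F k x \<partial>lborel) = (\<integral>\<^sup>+x. \<integral>\<^sup>+p. c k (fst p) x * c k (snd p) x \<partial>(M \<Otimes>\<^sub>M M) \<partial>lborel)"
      proof (intro nn_integral_cong)
        fix x
        have "(\<integral>\<^sup>+p. c k (fst p) x * c k (snd p) x \<partial>(M \<Otimes>\<^sub>M M)) = (\<integral>\<^sup>+\<omega>. \<integral>\<^sup>+\<omega>'. c k \<omega> x * c k \<omega>' x \<partial>M \<partial>M)"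
          unfolding c_alt by (subst nn_integral_fst[symmetric]) auto
        also have "\<dots> = F k x * F k x"
          unfolding F_def c_alt by (simp add: nn_integral_cmult nn_integral_multc)
        finally show "F k x * F k x = (\<integral>\<^sup>+p. c k (fst p) x * c k (snd p) x \<partial>(M \<Otimes>\<^sub>M M))" by simp
      qed
      also have "\<dots> = (\<integral>\<^sup>+p. \<integral>\<^sup>+x. c k (fst p) x * c k (snd p) x \<partial>lborel \<partial>(M \<Otimes>\<^sub>M M))"
        unfolding c_alt by (intro L2.Fubini') measurable
      also have "\<dots> \<le> (\<integral>\<^sup>+p. ennreal (\<rho> k) * indicator {p \<in> space (M \<Otimes>\<^sub>M M). \<bar>Y (fst p) - Y (snd p)\<bar> \<le> \<rho> k} p \<partial>(M \<Otimes>\<^sub>M M))"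
      proof (intro nn_integral_mono)
        fix p assume p: "p \<in> space (M \<Otimes>\<^sub>M M)"
        have "(\<integral>\<^sup>+x. c k (fst p) x * c k (snd p) x \<partial>lborel)
            \<le> (\<integral>\<^sup>+x. indicator {p \<in> space (M \<Otimes>\<^sub>M M). \<bar>Y (fst p) - Y (snd p)\<bar> \<le> \<rho> k} p
                 * indicator {Y (fst p) - \<rho> k / 2 .. Y (fst p) + \<rho> k / 2} x \<partial>lborel)"
          using p by (intro nn_integral_mono) (auto simp: c_def split: split_indicator)
        also have "\<dots> = indicator {p \<in> space (M \<Otimes>\<^sub>M M). \<bar>Y (fst p) - Y (snd p)\<bar> \<le> \<rho> k} p * ennreal (\<rho> k)"
          using \<rho>(1)[of k] by (subst nn_integral_cmult_indicator) auto
        finally show "(\<integral>\<^sup>+x. c k (fst p) x * c k (snd p) x \<partial>lborel) \<le>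
            ennreal (\<rho> k) * indicator {p \<in> space (M \<Otimes>\<^sub>M M). \<bar>Y (fst p) - Y (snd p)\<bar> \<le> \<rho> k} p"
          by (simp add: mult.commute)
      qed
      also have "\<dots> = ennreal (\<rho> k) * emeasure (M \<Otimes>\<^sub>M M) {p \<in> space (M \<Otimes>\<^sub>M M). \<bar>Y (fst p) - Y (snd p)\<bar> \<le> \<rho> k}"
        by (intro nn_integral_cmult_indicator) measurable
      also have "\<dots> \<le> ennreal (\<rho> k) * ennreal (L * \<rho> k)"
        by (intro mult_left_mono Q) auto
      finally show ?thesis .
    qed
    also have "ennreal (t / (2 * (\<rho> k)\<^sup>2)) * (ennreal (\<rho> k) * ennreal (L * \<rho> k)) = ennreal (t / 2 * L)"
      using \<rho>(1)[of k] t L by (simp add: ennreal_mult[symmetric] power2_eq_square)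
    finally show "(\<integral>\<^sup>+\<omega>. \<integral>\<^sup>+x. indicator U x * c k \<omega> x * ennreal (1 / \<rho> k) \<partial>lborel \<partial>M)
        \<le> ennreal (t / 2 * L) + ennreal (1 / (2 * t)) * emeasure lborel U"
      by (simp add: add_right_mono mult_left_mono)
  qed
  finally show ?thesis .
qed

text \<open>A null set is covered by an open set of measure below \<open>t\<^sup>2\<close>; the
  smoothing bound then gives mass at most \<open>t / 2 * L + t / 2\<close>, with \<open>t\<close>
  arbitrarily small.\<close>

lemma (in prob_space) has_ac_distribution_if_energy:
  fixes Y :: "'a \<Rightarrow> real"
  assumes Y[measurable]: "Y \<in> borel_measurable M"
    and \<rho>: "\<And>k. \<rho> k > 0" "\<rho> \<longlonglongrightarrow> 0"
    and Q: "\<And>k. emeasure (M \<Otimes>\<^sub>M M) {p \<in> space (M \<Otimes>\<^sub>M M). \<bar>Y (fst p) - Y (snd p)\<bar> \<le> \<rho> k} \<le> ennreal (L * \<rho> k)"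
    and L: "L \<ge> 0"
  shows "has_ac_distribution M Y"
  unfolding has_ac_distribution_def absolutely_continuous_def
proof safe
  fix N :: "real set" assume N: "N \<in> null_sets lborel"
  then have [measurable]: "N \<in> sets borel" by auto
  have "emeasure M {\<omega> \<in> space M. Y \<omega> \<in> N} \<le> 0"
  proof (rule ennreal_le_epsilon)
    fix e :: real assume e: "e > 0"
    define t where "t = e / (L + 1)"
    have t: "t > 0" using e L by (simp add: t_def)
    obtain U where U: "open U" "N \<subseteq> U" "emeasure lborel (U - N) < ennreal (t\<^sup>2)"
      using outer_regular_lborel[of N "t\<^sup>2"] t by auto
    have "emeasure lborel U = emeasure lborel (U - N)"
      using N U by (simp add: emeasure_Diff_null_set)
    then have lU: "emeasure lborel U \<le> ennreal (t\<^sup>2)" using U(3) by simp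
    have [measurable]: "U \<in> sets borel" using U by simp
    have "emeasure M {\<omega> \<in> space M. Y \<omega> \<in> N} \<le> emeasure M {\<omega> \<in> space M. Y \<omega> \<in> U}"
      using U(2) by (intro emeasure_mono) auto
    also have "\<dots> \<le> ennreal (t / 2 * L) + ennreal (1 / (2 * t)) * emeasure lborel U"
      by (rule emeasure_open_le_energy[OF Y \<rho> Q L U(1) t])
    also have "\<dots> \<le> ennreal (t / 2 * L) + ennreal (1 / (2 * t)) * ennreal (t\<^sup>2)"
      by (intro add_left_mono mult_left_mono lU) auto
    also have "\<dots> = ennreal (t / 2 * L + t / 2)"
      using t L by (simp add: ennreal_mult[symmetric] power2_eq_square)
    also have "\<dots> \<le> ennreal e"
    proof (intro ennreal_leI)
      have "t * (L + 1) = e" using L by (simp add: t_def)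
      then show "t / 2 * L + t / 2 \<le> e" using e by (simp add: algebra_simps)
    qed
    finally show "emeasure M {\<omega> \<in> space M. Y \<omega> \<in> N} \<le> 0 + ennreal e" by simp
  qed
  then have "emeasure (distr M borel Y) N = 0"
    by (simp add: emeasure_distr vimage_def Int_def conj_commute)
  then show "N \<in> null_sets (distr M borel Y)" by (auto simp: null_sets_def)
qed measurable

subsection \<open>Integrating the energy over the parameter\<close>

lemma emeasure_lborel_le_diameter:
  fixes A :: "real set"
  assumes "A \<in> sets borel" "\<And>r s. r \<in> A \<Longrightarrow> s \<in> A \<Longrightarrow> r \<le> s \<Longrightarrow> s - r \<le> \<delta>"
  shows "emeasure lborel A \<le> ennreal (2 * \<delta>)"
proof (cases "A = {}")
  case False
  then obtain a where a: "a \<in> A" by blast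
  have d0: "\<delta> \<ge> 0" using assms(2)[OF a a] by simp
  have "A \<subseteq> {a - \<delta> .. a + \<delta>}"
  proof
    fix s assume s: "s \<in> A"
    show "s \<in> {a - \<delta> .. a + \<delta>}"
      using assms(2)[OF a s] assms(2)[OF s a] d0 by (cases "a \<le> s") auto
  qed
  then have "emeasure lborel A \<le> emeasure lborel {a - \<delta> .. a + \<delta>}"
    by (intro emeasure_mono) auto
  then show ?thesis using d0 by simp
qed simp

text \<open>For a pair of copies first differing at digit \<open>n\<close>, transversality bounds
  the measure of the parameters at which they are within \<open>\<rho>\<close> by
  \<open>K * \<rho> / a ^ n\<close>. Such pairs have probability at most
  \<open>C * \<theta> ^ n\<close>, and \<open>\<theta> < a\<close> makes the sum over
  \<open>n\<close> converge. The exponent \<open>m\<close> serves series in a power of the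
  parameter.\<close>

lemma AE_absolutely_continuous_of_transversality:
  fixes X :: "nat \<Rightarrow> 'a \<Rightarrow> real"
  assumes "prob_space M"
    and X[measurable]: "\<And>k. X k \<in> borel_measurable M"
    and X01: "\<And>k \<omega>. X k \<omega> = 0 \<or> X k \<omega> = 1"
    and supp: "\<And>k \<omega>. k \<notin> T \<Longrightarrow> X k \<omega> = 0"
    and E: "\<And>n. emeasure (M \<Otimes>\<^sub>M M) {p \<in> space (M \<Otimes>\<^sub>M M). \<forall>k<n. X k (fst p) = X k (snd p)} \<le> ennreal (C * \<theta> ^ n)"
    and par: "C \<ge> 0" "0 < \<theta>" "\<theta> < a" "x < 1" "\<kappa> > 0" "\<eta> > 0" "m \<ge> 1"
    and v: "\<And>n. n \<in> T \<Longrightarrow> \<exists>v. (\<forall>i. v i \<ge> 0) \<and> (\<forall>i\<ge>1. n + i \<in> T \<longrightarrow> \<bar>real i - \<kappa>\<bar> * x ^ i \<le> v i)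
              \<and> summable v \<and> suminf v \<le> \<kappa> - \<eta>"
  shows "AE r in lborel. 0 \<le> r \<longrightarrow> a \<le> r ^ m \<longrightarrow> r ^ m \<le> x \<longrightarrow>
           has_ac_distribution M (\<lambda>\<omega>. \<Sum>k. X k \<omega> * (r ^ m) ^ k)"
proof -
  interpret prob_space M by fact
  interpret P: pair_prob_space M M ..
  interpret L: pair_sigma_finite "M \<Otimes>\<^sub>M M" lborel ..
  let ?Q = "M \<Otimes>\<^sub>M M"
  have a0: "a > 0" using par by simp
  define J where "J = {r::real. 0 \<le> r \<and> a \<le> r ^ m \<and> r ^ m \<le> x}"
  have [measurable]: "J \<in> sets borel" unfolding J_def by measurable
  have J1: "r \<in> {0..1}" if "r \<in> J" for r
    using that par power_le_one_iff[of r m] by (auto simp: J_def)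
  define D where "D r p = (\<Sum>k. (X k (fst p) - X k (snd p)) * (r ^ m) ^ k)" for r p
  have Dm[measurable]: "(\<lambda>z. D (snd z) (fst z)) \<in> borel_measurable (?Q \<Otimes>\<^sub>M lborel)"
    unfolding D_def by measurable
  have Dm1[measurable]: "(\<lambda>r. D r p) \<in> borel_measurable borel" for p
    unfolding D_def by measurable
  have Dm2[measurable]: "(\<lambda>p. D r p) \<in> borel_measurable ?Q" for r
    unfolding D_def by measurable
  define En where "En n = {p \<in> space ?Q. \<forall>k<n. X k (fst p) = X k (snd p)}" for n
  have [measurable]: "En n \<in> sets ?Q" for n unfolding En_def by measurable
  \<comment> \<open>Inside the parentheses stands the diameter constant in terms of
    \<open>r ^ m\<close>, divided by \<open>a\<close> to pass to \<open>r\<close>; the outer 2 turns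
    diameter into measure.\<close>
  define K where "K = 2 * (2 * a powr (-\<kappa>) / \<eta> / a)"
  have K0: "K > 0" using a0 par by (simp add: K_def)

  \<comment> \<open>The term at the first differing index already dominates; the sum over all
    \<open>n\<close> is a majorant that can be integrated term by term.\<close>
  have A: "emeasure lborel {r \<in> J. \<bar>D r p\<bar> \<le> \<rho>} \<le> (\<Sum>n. indicator (En n) p * ennreal (K * \<rho> / a ^ n))"
    if p: "p \<in> space ?Q" and \<rho>: "\<rho> > 0" for p \<rho>
  proof (cases "\<forall>k. X k (fst p) = X k (snd p)")
    \<comment> \<open>If the copies agree throughout, every term is at least
      \<open>K * \<rho>\<close>, so finitely many of them reach the length of \<open>{0..1}\<close>,
      which contains \<open>J\<close>.\<close>
    case True
    have axle: "a \<le> 1" if "J \<noteq> {}" using that par by (auto simp: J_def)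
    show ?thesis
    proof (cases "J = {}")
      case False
      obtain N :: nat where N: "1 \<le> real N * (K * \<rho>)"
        using K0 \<rho> reals_Archimedean3[of "K * \<rho>"] by (meson less_imp_le mult_pos_pos)
      have "emeasure lborel {r \<in> J. \<bar>D r p\<bar> \<le> \<rho>} \<le> emeasure lborel {0..1::real}"
        using J1 by (intro emeasure_mono) auto
      also have "\<dots> \<le> ennreal (real N * (K * \<rho>))" using N by simp
      also have "\<dots> = (\<Sum>n<N. ennreal (K * \<rho>))"
        using K0 \<rho> by (simp add: ennreal_mult ennreal_of_nat_eq_real_of_nat)
      also have "\<dots> \<le> (\<Sum>n<N. indicator (En n) p * ennreal (K * \<rho> / a ^ n))"
      proof (intro sum_mono)
        fix n
        have "a ^ n \<le> 1" using axle[OF False] a0 by (intro power_le_one) auto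
        then have "K * \<rho> \<le> K * \<rho> / a ^ n"
          using K0 \<rho> a0 by (simp add: field_simps)
        then show "ennreal (K * \<rho>) \<le> indicator (En n) p * ennreal (K * \<rho> / a ^ n)"
          using True p by (simp add: En_def ennreal_leI)
      qed
      also have "\<dots> \<le> (\<Sum>n. indicator (En n) p * ennreal (K * \<rho> / a ^ n))"
        by (intro sum_le_suminf) auto
      finally show ?thesis .
    qed simp
  next
    case False
    define n where "n = (LEAST k. X k (fst p) \<noteq> X k (snd p))"
    have n1: "X n (fst p) \<noteq> X n (snd p)" unfolding n_def using False by (metis (mono_tags, lifting) LeastI)
    have n2: "X k (fst p) = X k (snd p)" if "k < n" for k
      using that not_less_Least unfolding n_def by blast
    define d where "d k = X k (fst p) - X k (snd p)" for k
    have nT: "n \<in> T" using n1 supp by metis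
    have d1: "\<bar>d k\<bar> \<le> 1" for k using X01[of k "fst p"] X01[of k "snd p"] by (auto simp: d_def)
    have dn: "\<bar>d n\<bar> = 1" using n1 X01[of n "fst p"] X01[of n "snd p"] by (auto simp: d_def)
    obtain w where w: "\<And>i. w i \<ge> 0" "\<And>i. i \<ge> 1 \<Longrightarrow> n + i \<in> T \<Longrightarrow> \<bar>real i - \<kappa>\<bar> * x ^ i \<le> w i"
      "summable w" "suminf w \<le> \<kappa> - \<eta>"
      using v[OF nT] by blast
    have "emeasure lborel {r \<in> J. \<bar>D r p\<bar> \<le> \<rho>} \<le> ennreal (2 * (2 * a powr (-\<kappa>) / \<eta> * \<rho> / a ^ n / a))"
    proof (rule emeasure_lborel_le_diameter)
      fix r s assume "r \<in> {r \<in> J. \<bar>D r p\<bar> \<le> \<rho>}" "s \<in> {r \<in> J. \<bar>D r p\<bar> \<le> \<rho>}" and rs: "r \<le> s"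
      then have r: "r \<in> J" "\<bar>D r p\<bar> \<le> \<rho>" and s: "s \<in> J" "\<bar>D s p\<bar> \<le> \<rho>" by auto
      have r01: "0 \<le> r" "r \<le> 1" using J1[OF r(1)] by auto
      have "s ^ m - r ^ m \<le> 2 * a powr (-\<kappa>) / \<eta> * \<rho> / a ^ n"
      proof (rule series_sublevel_diameter[where d = d and v = w and x = x])
        show "\<bar>real i - \<kappa>\<bar> * x ^ i \<le> w i" if "i \<ge> 1" "d (n + i) \<noteq> 0" for i
        proof (rule w(2)[OF that(1)])
          show "n + i \<in> T" using that(2) supp unfolding d_def by (metis diff_self)
        qed
        show "d k = 0" if "k < n" for k using n2[OF that] by (simp add: d_def)
        show "r ^ m \<le> s ^ m" using rs r01 by (intro power_mono) auto
        show "\<bar>\<Sum>i. d i * (r ^ m) ^ i\<bar> \<le> \<rho>" "\<bar>\<Sum>i. d i * (s ^ m) ^ i\<bar> \<le> \<rho>"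
          using r s by (auto simp: D_def d_def)
      qed (use dn d1 w par a0 r s in \<open>auto simp: J_def\<close>)
      \<comment> \<open>With \<open>m = Suc l\<close>:
        \<open>s ^ m - r ^ m \<ge> r ^ l * (s - r)\<close>, and
        \<open>r ^ l \<ge> r ^ m \<ge> a\<close> because \<open>r \<le> 1\<close>.\<close>
      moreover have "a * (s - r) \<le> s ^ m - r ^ m"
      proof -
        obtain l where l: "m = Suc l" using \<open>m \<ge> 1\<close> by (cases m) auto
        have "r ^ l \<le> s ^ l" using rs r01 by (intro power_mono) auto
        then have "s * r ^ l \<le> s ^ m" using rs r01 by (simp add: l mult_left_mono)
        moreover have "a \<le> r ^ l"
          using r(1) r01 mult_left_le_one_le[of "r ^ l" r] by (auto simp: J_def l)
        then have "a * (s - r) \<le> r ^ l * (s - r)" using rs by (intro mult_right_mono) auto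
        ultimately show ?thesis by (simp add: l algebra_simps)
      qed
      ultimately have "(s - r) * a \<le> 2 * a powr (-\<kappa>) / \<eta> * \<rho> / a ^ n"
        by (simp only: mult.commute[of "s - r"])
      then show "s - r \<le> 2 * a powr (-\<kappa>) / \<eta> * \<rho> / a ^ n / a"
        using a0 by (simp only: pos_le_divide_eq)
    qed measurable
    also have "\<dots> = indicator (En n) p * ennreal (K * \<rho> / a ^ n)"
      using p n2 by (simp add: En_def K_def field_simps)
    also have "\<dots> \<le> (\<Sum>n. indicator (En n) p * ennreal (K * \<rho> / a ^ n))"
    proof -
      have "g n \<le> suminf g" for g :: "nat \<Rightarrow> ennreal" using sum_le_suminf[of g "{n}"] by simp
      then show ?thesis .
    qed
    finally show ?thesis .
  qed

  define B where "B \<rho> r = {p \<in> space ?Q. \<bar>D r p\<bar> \<le> \<rho>}" for \<rho> r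
  define K' where "K' = K * C * (1 / (1 - \<theta> / a))"
  have K'0: "K' \<ge> 0" using K0 par a0 by (simp add: K'_def)
  have EB: "(\<integral>\<^sup>+r. indicator J r * emeasure ?Q (B \<rho> r) \<partial>lborel) \<le> ennreal (K' * \<rho>)" if \<rho>: "\<rho> > 0" for \<rho>
  proof -
    have "(\<integral>\<^sup>+r. indicator J r * emeasure ?Q (B \<rho> r) \<partial>lborel)
        = (\<integral>\<^sup>+r. \<integral>\<^sup>+p. (if r \<in> J \<and> \<bar>D r p\<bar> \<le> \<rho> then 1 else 0) \<partial>?Q \<partial>lborel)"
    proof (intro nn_integral_cong)
      fix r
      have "(\<integral>\<^sup>+p. (if r \<in> J \<and> \<bar>D r p\<bar> \<le> \<rho> then 1 else 0) \<partial>?Q) = (\<integral>\<^sup>+p. indicator J r * indicator (B \<rho> r) p \<partial>?Q)"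
        by (intro nn_integral_cong) (auto simp: B_def split: split_indicator)
      also have "\<dots> = indicator J r * emeasure ?Q (B \<rho> r)"
        unfolding B_def by (intro nn_integral_cmult_indicator) measurable
      finally show "indicator J r * emeasure ?Q (B \<rho> r)
        = (\<integral>\<^sup>+p. (if r \<in> J \<and> \<bar>D r p\<bar> \<le> \<rho> then 1 else 0) \<partial>?Q)" by simp
    qed
    also have "\<dots> = (\<integral>\<^sup>+p. \<integral>\<^sup>+r. (if r \<in> J \<and> \<bar>D r p\<bar> \<le> \<rho> then 1 else 0) \<partial>lborel \<partial>?Q)"
      by (intro L.Fubini') measurable
    also have "\<dots> = (\<integral>\<^sup>+p. emeasure lborel {r \<in> J. \<bar>D r p\<bar> \<le> \<rho>} \<partial>?Q)"
      using nn_integral_if_eq_emeasure[of lborel "\<lambda>r. r \<in> J \<and> \<bar>D r p\<bar> \<le> \<rho>" for p]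
      by simp
    also have "\<dots> \<le> (\<integral>\<^sup>+p. (\<Sum>n. indicator (En n) p * ennreal (K * \<rho> / a ^ n)) \<partial>?Q)"
      using A \<rho> by (intro nn_integral_mono) auto
    also have "\<dots> = (\<Sum>n. emeasure ?Q (En n) * ennreal (K * \<rho> / a ^ n))"
      by (simp add: nn_integral_suminf nn_integral_multc)
    also have "\<dots> \<le> (\<Sum>n. ennreal (K * C * \<rho> * (\<theta> / a) ^ n))"
    proof (intro suminf_le)
      fix n
      have "emeasure ?Q (En n) * ennreal (K * \<rho> / a ^ n) \<le> ennreal (C * \<theta> ^ n) * ennreal (K * \<rho> / a ^ n)"
        unfolding En_def by (intro mult_right_mono E) auto
      also have "\<dots> = ennreal (K * C * \<rho> * (\<theta> / a) ^ n)"
        using par K0 \<rho> a0 by (simp add: ennreal_mult[symmetric] power_divide field_simps)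
      finally show "emeasure ?Q (En n) * ennreal (K * \<rho> / a ^ n) \<le> ennreal (K * C * \<rho> * (\<theta> / a) ^ n)" .
    qed auto
    also have "\<dots> = ennreal (K' * \<rho>)"
    proof (rule suminf_ennreal_eq)
      have "(\<lambda>n. (\<theta> / a) ^ n) sums (1 / (1 - \<theta> / a))"
        using par a0 by (intro geometric_sums) auto
      from sums_mult[OF this, of "K * C * \<rho>"]
      show "(\<lambda>n. K * C * \<rho> * (\<theta> / a) ^ n) sums (K' * \<rho>)" by (simp add: K'_def mult_ac)
    qed (use par K0 \<rho> a0 in auto)
    finally show ?thesis .
  qed

  \<comment> \<open>On \<open>J\<close>, the pair probability at scale \<open>1 / Suc k\<close>
    divided by that scale. Its integral is bounded uniformly in \<open>k\<close>, so by Fatou the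
    liminf is finite almost everywhere.\<close>
  define W where "W k r = indicator J r * emeasure ?Q (B (1 / Suc k) r) * ennreal (Suc k)" for k r
  have Wm[measurable]: "(\<lambda>r. emeasure ?Q (B \<rho> r)) \<in> borel_measurable lborel" for \<rho>
  proof -
    have "(\<lambda>r. emeasure ?Q (B \<rho> r)) = (\<lambda>r. \<integral>\<^sup>+p. (if \<bar>D r p\<bar> \<le> \<rho> then 1 else 0) \<partial>?Q)"
      unfolding B_def
      by (intro ext nn_integral_if_eq_emeasure[symmetric]) measurable
    moreover have "(\<lambda>z. D (fst z) (snd z)) \<in> borel_measurable (lborel \<Otimes>\<^sub>M ?Q)"
      unfolding D_def by measurable
    then have "(\<lambda>r. \<integral>\<^sup>+p. (if \<bar>D r p\<bar> \<le> \<rho> then 1 else 0) \<partial>?Q) \<in> borel_measurable lborel"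
      by measurable
    ultimately show ?thesis by simp
  qed
  have WJ: "(\<integral>\<^sup>+r. W k r \<partial>lborel) \<le> ennreal K'" for k
  proof -
    have "(\<integral>\<^sup>+r. W k r \<partial>lborel) = (\<integral>\<^sup>+r. indicator J r * emeasure ?Q (B (1 / Suc k) r) \<partial>lborel) * ennreal (Suc k)"
      unfolding W_def by (intro nn_integral_multc) measurable
    also have "\<dots> \<le> ennreal (K' * (1 / Suc k)) * ennreal (Suc k)"
      by (intro mult_right_mono EB) auto
    also have "\<dots> = ennreal K'"
      using K'0 by (simp add: ennreal_mult[symmetric] del: of_nat_Suc)
    finally show ?thesis .
  qed
  have "(\<integral>\<^sup>+r. liminf (\<lambda>k. W k r) \<partial>lborel) \<le> liminf (\<lambda>k. \<integral>\<^sup>+r. W k r \<partial>lborel)"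
    unfolding W_def by (intro nn_integral_liminf) measurable
  also have "\<dots> \<le> limsup (\<lambda>k. \<integral>\<^sup>+r. W k r \<partial>lborel)" by (intro Liminf_le_Limsup) simp
  also have "\<dots> \<le> ennreal K'" by (intro Limsup_bounded always_eventually allI WJ)
  also have "\<dots> < \<infinity>" by simp
  finally have "AE r in lborel. liminf (\<lambda>k. W k r) \<noteq> \<infinity>"
    unfolding W_def by (intro nn_integral_PInf_AE) auto
  then show ?thesis
  proof eventually_elim
    case (elim r)
    show ?case
    proof (intro impI)
      assume "0 \<le> r" "a \<le> r ^ m" "r ^ m \<le> x"
      then have rJ: "r \<in> J" by (simp add: J_def)
      have rm: "0 \<le> r ^ m" "r ^ m < 1" using \<open>0 \<le> r\<close> \<open>r ^ m \<le> x\<close> par by auto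
      obtain l where l: "liminf (\<lambda>k. W k r) = ennreal l" "l \<ge> 0"
        using elim by (cases "liminf (\<lambda>k. W k r)") auto
      have "\<exists>k\<ge>j. W k r \<le> ennreal (l + 1)" for j
      proof (rule ccontr)
        assume "\<not> ?thesis"
        then have "\<forall>\<^sub>F k in sequentially. ennreal (l + 1) \<le> W k r"
          by (auto simp: eventually_sequentially intro!: exI[of _ j])
        then have "ennreal (l + 1) \<le> ennreal l" unfolding l(1)[symmetric] by (rule Liminf_bounded)
        then show False using l(2) by (simp add: ennreal_le_iff)
      qed
      \<comment> \<open>\<open>\<sigma>\<close> selects scales along which the quotient stays at
        most \<open>l + 1\<close>; \<open>\<sigma> j \<ge> j\<close> sends these scales to
        0.\<close>
      then obtain \<sigma> where \<sigma>: "\<And>j. \<sigma> j \<ge> j" "\<And>j. W (\<sigma> j) r \<le> ennreal (l + 1)" by metis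
      have diff: "(\<Sum>k. X k (fst p) * (r ^ m) ^ k) - (\<Sum>k. X k (snd p) * (r ^ m) ^ k) = D r p" for p
      proof -
        have "summable (\<lambda>k. X k \<omega> * (r ^ m) ^ k)" for \<omega>
        proof (rule summable_bounded_coeff_power)
          show "\<bar>X i \<omega>\<bar> \<le> 1" for i using X01[of i \<omega>] by auto
        qed (use rm in auto)
        then show ?thesis unfolding D_def by (simp add: suminf_diff left_diff_distrib)
      qed
      show "has_ac_distribution M (\<lambda>\<omega>. \<Sum>k. X k \<omega> * (r ^ m) ^ k)"
      proof (rule has_ac_distribution_if_energy)
        show "(\<lambda>j. 1 / Suc (\<sigma> j)) \<longlonglongrightarrow> (0::real)"
        proof (rule tendsto_sandwich[of "\<lambda>_. 0" _ _ "\<lambda>j. 1 / real (Suc j)"])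
          show "\<forall>\<^sub>F j in sequentially. 1 / Suc (\<sigma> j) \<le> 1 / real (Suc j)"
            using \<sigma>(1) by (intro always_eventually allI divide_left_mono) auto
          show "(\<lambda>j. 1 / real (Suc j)) \<longlonglongrightarrow> 0" by (rule LIMSEQ_Suc[OF lim_1_over_n])
        qed auto
        show "emeasure ?Q {p \<in> space ?Q. \<bar>(\<Sum>k. X k (fst p) * (r ^ m) ^ k) - (\<Sum>k. X k (snd p) * (r ^ m) ^ k)\<bar> \<le> 1 / Suc (\<sigma> j)}
            \<le> ennreal ((l + 1) * (1 / Suc (\<sigma> j)))" for j
        proof -
          have "emeasure ?Q (B (1 / Suc (\<sigma> j)) r) = W (\<sigma> j) r * ennreal (1 / Suc (\<sigma> j))"
            using rJ by (simp add: W_def mult.assoc ennreal_mult[symmetric] del: of_nat_Suc)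
          also have "\<dots> \<le> ennreal (l + 1) * ennreal (1 / Suc (\<sigma> j))"
            by (intro mult_right_mono \<sigma>) auto
          also have "\<dots> = ennreal ((l + 1) * (1 / Suc (\<sigma> j)))"
            using l(2) by (intro ennreal_mult[symmetric]) auto
          finally show ?thesis unfolding diff B_def .
        qed
      qed (use l in auto)
    qed
  qed
qed

subsection \<open>Independence\<close>

text \<open>With the first copy fixed at \<open>\<omega>\<close>, independence makes the probability
  of agreement the product of the probabilities of the values \<open>X k \<omega>\<close>. On
  integrating over \<open>\<omega>\<close> independence applies again, and each factor averages to
  the sum of two squares.\<close>

lemma (in prob_space) emeasure_pair_agree:
  fixes X :: "nat \<Rightarrow> 'a \<Rightarrow> real"
  assumes ind: "indep_vars (\<lambda>_. borel) X I" and F: "finite F" "F \<subseteq> I"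
    and X01: "\<And>k \<omega>. k \<in> I \<Longrightarrow> X k \<omega> = 0 \<or> X k \<omega> = 1"
  shows "emeasure (M \<Otimes>\<^sub>M M) {p \<in> space (M \<Otimes>\<^sub>M M). \<forall>k\<in>F. X k (fst p) = X k (snd p)}
    = ennreal (\<Prod>k\<in>F. (prob {\<omega> \<in> space M. X k \<omega> = 0})\<^sup>2 + (prob {\<omega> \<in> space M. X k \<omega> = 1})\<^sup>2)"
proof (cases "F = {}")
  case True
  interpret P: pair_prob_space M M ..
  show ?thesis using P.emeasure_space_1 True by simp
next
  case False
  interpret P: pair_prob_space M M ..
  have X[measurable]: "X k \<in> borel_measurable M" if "k \<in> I" for k
    using ind that by (auto simp: indep_vars_def)
  then have XF[measurable]: "X k \<in> borel_measurable M" if "k \<in> F" for k using that F by auto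
  define q where "q k c = prob {\<omega> \<in> space M. X k \<omega> = c}" for k and c :: real
  \<comment> \<open>A stand-in for \<open>q k\<close>, equal to it at 0 and 1 and evidently
    measurable in \<open>c\<close>.\<close>
  define h where "h k c = (if c = 0 then q k 0 else q k 1)" for k and c :: real
  have h0: "h k c \<ge> 0" for k c by (simp add: h_def q_def)
  have hX: "h k (X k \<omega>) = q k (X k \<omega>)" if "k \<in> F" for k \<omega>
    using X01[of k \<omega>] that F by (auto simp: h_def)
  have hm[measurable]: "h k \<in> borel_measurable borel" for k unfolding h_def by measurable
  let ?A = "{p \<in> space (M \<Otimes>\<^sub>M M). \<forall>k\<in>F. X k (fst p) = X k (snd p)}"
  have Am: "?A \<in> sets (M \<Otimes>\<^sub>M M)" using F(1) by measurable
  have "emeasure (M \<Otimes>\<^sub>M M) ?A = (\<integral>\<^sup>+\<omega>. emeasure M (Pair \<omega> -` ?A) \<partial>M)"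
    by (rule emeasure_pair_measure_alt[OF Am])
  also have "\<dots> = (\<integral>\<^sup>+\<omega>. (\<Prod>k\<in>F. ennreal (h k (X k \<omega>))) \<partial>M)"
  proof (intro nn_integral_cong)
    fix \<omega> assume \<omega>: "\<omega> \<in> space M"
    have "Pair \<omega> -` ?A = (\<Inter>k\<in>F. X k -` {X k \<omega>} \<inter> space M)"
      using False \<omega> by (auto simp: space_pair_measure)
    then have "emeasure M (Pair \<omega> -` ?A) = ennreal (prob (\<Inter>k\<in>F. X k -` {X k \<omega>} \<inter> space M))"
      by (simp add: emeasure_eq_measure)
    also have "prob (\<Inter>k\<in>F. X k -` {X k \<omega>} \<inter> space M) = (\<Prod>k\<in>F. prob (X k -` {X k \<omega>} \<inter> space M))"
      by (rule indep_varsD[OF ind False F]) auto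
    also have "\<dots> = (\<Prod>k\<in>F. h k (X k \<omega>))"
      by (intro prod.cong refl, simp only: hX, unfold q_def) (auto intro!: arg_cong[where f = prob])
    finally show "emeasure M (Pair \<omega> -` ?A) = (\<Prod>k\<in>F. ennreal (h k (X k \<omega>)))"
      using h0 by (simp add: prod_ennreal)
  qed
  also have "\<dots> = (\<Prod>k\<in>F. \<integral>\<^sup>+\<omega>. ennreal (h k (X k \<omega>)) \<partial>M)"
    using F(1)
  proof (rule indep_vars_nn_integral)
    show "indep_vars (\<lambda>_. borel) (\<lambda>k \<omega>. ennreal (h k (X k \<omega>))) F"
      by (rule indep_vars_compose2[OF indep_vars_subset[OF ind F(2)]]) measurable
  qed simp
  also have "\<dots> = (\<Prod>k\<in>F. ennreal ((q k 0)\<^sup>2 + (q k 1)\<^sup>2))"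
  proof (intro prod.cong refl)
    fix k assume k: "k \<in> F"
    note [measurable] = XF[OF k]
    have "(\<integral>\<^sup>+\<omega>. ennreal (h k (X k \<omega>)) \<partial>M)
       = (\<integral>\<^sup>+\<omega>. ennreal (q k 0) * indicator {\<omega> \<in> space M. X k \<omega> = 0} \<omega>
           + ennreal (q k 1) * indicator {\<omega> \<in> space M. X k \<omega> = 1} \<omega> \<partial>M)"
    proof (intro nn_integral_cong)
      fix \<omega> assume "\<omega> \<in> space M"
      then show "ennreal (h k (X k \<omega>)) = ennreal (q k 0) * indicator {\<omega> \<in> space M. X k \<omega> = 0} \<omega>
           + ennreal (q k 1) * indicator {\<omega> \<in> space M. X k \<omega> = 1} \<omega>"
        using X01[of k \<omega>] k F by (auto simp: h_def)
    qed
    also have "\<dots> = ennreal (q k 0) * ennreal (q k 0) + ennreal (q k 1) * ennreal (q k 1)"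
      by (subst nn_integral_add) (auto simp: nn_integral_cmult_indicator emeasure_eq_measure q_def)
    also have "\<dots> = ennreal ((q k 0)\<^sup>2 + (q k 1)\<^sup>2)"
      by (simp add: q_def ennreal_mult[symmetric] power2_eq_square)
    finally show "(\<integral>\<^sup>+\<omega>. ennreal (h k (X k \<omega>)) \<partial>M) = ennreal ((q k 0)\<^sup>2 + (q k 1)\<^sup>2)" .
  qed
  also have "\<dots> = ennreal (\<Prod>k\<in>F. (q k 0)\<^sup>2 + (q k 1)\<^sup>2)" by (intro prod_ennreal) auto
  finally show ?thesis by (simp add: q_def)
qed

text \<open>With \<open>e k\<close> the squared bias, \<open>p0 k + p1 k = 1\<close> makes each
  factor \<open>1 / 2 * (1 + 4 * e k)\<close>, at most \<open>1 / 2 * exp (4 * e k)\<close>. Square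
  summability bounds the product of the exponentials uniformly in \<open>F\<close>.\<close>

lemma prod_square_sum_le:
  fixes p0 p1 :: "nat \<Rightarrow> real"
  assumes p: "\<And>k. k \<ge> 1 \<Longrightarrow> p0 k + p1 k = 1" and s: "summable (\<lambda>k. (1 / 2 - p0 (Suc k))\<^sup>2)"
    and F: "finite F" "F \<subseteq> {1..}"
  shows "(\<Prod>k\<in>F. (p0 k)\<^sup>2 + (p1 k)\<^sup>2) \<le> exp (4 * (\<Sum>k. (1 / 2 - p0 (Suc k))\<^sup>2)) * (1 / 2) ^ card F"
proof -
  define e where "e k = (1 / 2 - p0 k)\<^sup>2" for k
  have S: "sum e F \<le> (\<Sum>k. e (Suc k))"
  proof -
    \<comment> \<open>\<open>F\<close> avoids 0, so its elements are successors, matching the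
      shifted index of the series.\<close>
    have "F = Suc ` ((\<lambda>k. k - 1) ` F)" using F(2) by (force simp: image_image)
    then have "sum e F = (\<Sum>k\<in>(\<lambda>k. k - 1) ` F. e (Suc k))"
      by (metis (no_types, lifting) inj_Suc inj_on_subset subset_UNIV sum.reindex_cong)
    also have "\<dots> \<le> (\<Sum>k. e (Suc k))"
      using s F by (intro sum_le_suminf) (auto simp: e_def)
    finally show ?thesis .
  qed
  have "(\<Prod>k\<in>F. (p0 k)\<^sup>2 + (p1 k)\<^sup>2) \<le> (\<Prod>k\<in>F. 1 / 2 * exp (4 * e k))"
  proof (intro prod_mono conjI)
    fix k assume "k \<in> F"
    then have k: "p1 k = 1 - p0 k" using F p[of k] by (auto simp: subset_iff algebra_simps)
    have "(p0 k)\<^sup>2 + (p1 k)\<^sup>2 = 1 / 2 * (1 + 4 * e k)"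
      by (simp add: k e_def power2_eq_square algebra_simps)
    also have "\<dots> \<le> 1 / 2 * exp (4 * e k)" by (intro mult_left_mono exp_ge_add_one_self) auto
    finally show "(p0 k)\<^sup>2 + (p1 k)\<^sup>2 \<le> 1 / 2 * exp (4 * e k)" .
  qed simp
  also have "\<dots> = (1 / 2) ^ card F * exp (4 * sum e F)"
    by (simp only: prod.distrib prod_constant exp_sum[OF F(1)] sum_distrib_left)
  also have "\<dots> \<le> (1 / 2) ^ card F * exp (4 * (\<Sum>k. e (Suc k)))"
    using S by (intro mult_left_mono) auto
  finally show ?thesis by (simp add: e_def mult.commute)
qed

text \<open>The law of the sum is a convolution: the mass of \<open>N\<close> is an average of the
  masses that the law of \<open>Y\<close> gives to translates of \<open>N\<close>, which are
  Lebesgue null along with \<open>N\<close>.\<close>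

lemma (in prob_space) has_ac_distribution_add_indep:
  fixes Y Z :: "'a \<Rightarrow> real"
  assumes ind: "indep_var borel Z borel Y" and Y: "has_ac_distribution M Y"
  shows "has_ac_distribution M (\<lambda>\<omega>. Z \<omega> + Y \<omega>)"
proof -
  have [measurable]: "Z \<in> borel_measurable M" using ind by (rule indep_var_rv1)
  have [measurable]: "Y \<in> borel_measurable M" using ind by (rule indep_var_rv2)
  interpret DY: prob_space "distr M borel Y" by (rule prob_space_distr) measurable
  interpret DZ: prob_space "distr M borel Z" by (rule prob_space_distr) measurable
  show ?thesis
    unfolding has_ac_distribution_def absolutely_continuous_def
  proof safe
    fix N :: "real set" assume N: "N \<in> null_sets lborel"
    then have Nb: "N \<in> sets borel" by auto
    have tr: "emeasure (distr M borel Y) {b. b + z \<in> N} = 0" for z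
    proof -
      have "{b. b - (- z) \<in> N} \<in> null_sets lborel" by (rule null_sets_translation[OF N])
      then show ?thesis using Y by (auto simp: has_ac_distribution_def absolutely_continuous_def null_sets_def)
    qed
    have "emeasure (distr M borel (\<lambda>\<omega>. Z \<omega> + Y \<omega>)) N
        = emeasure (convolution (distr M borel Z) (distr M borel Y)) N"
      using ind by (subst sum_indep_random_variable) auto
    also have "\<dots> = (\<integral>\<^sup>+z. emeasure (distr M borel Y) {b. b + z \<in> N} \<partial>distr M borel Z)"
      using Nb DY.finite_measure_axioms DZ.finite_measure_axioms by (intro convolution_emeasure) auto
    also have "\<dots> = 0" by (simp add: tr)
    finally show "N \<in> null_sets (distr M borel (\<lambda>\<omega>. Z \<omega> + Y \<omega>))" using Nb by (auto simp: null_sets_def)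
  qed measurable
qed

lemma has_ac_distribution_cong_AE:
  assumes "AE \<omega> in M. X \<omega> = Y \<omega>" "X \<in> borel_measurable M" "has_ac_distribution M Y"
  shows "has_ac_distribution M X"
proof -
  have "distr M borel X = distr M borel Y"
    using assms by (intro distr_cong_AE) (auto simp: has_ac_distribution_def)
  then show ?thesis using assms by (simp add: has_ac_distribution_def)
qed

subsection \<open>Numerical bounds\<close>

text \<open>All numerical bounds take \<open>\<kappa> = 4\<close>. A finite number of weights is kept exact and the tail is
  majorised by the weights of the full digit set.\<close>

lemma geometric_weight_sums:
  fixes w :: "nat \<Rightarrow> real"
  assumes "0 < x" "x < 1"
  shows "(\<lambda>i. if i < N then w i else (real i - 4) * x ^ i) sums
    (1 / (1 - x)\<^sup>2 - 5 / (1 - x) + (\<Sum>i<N. w i - (real i - 4) * x ^ i))"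
proof -
  \<comment> \<open>Writing \<open>i - 4\<close> as \<open>(i + 1) - 5\<close> reduces the sum to
    the geometric series and its derivative.\<close>
  have "(\<lambda>i. of_nat (Suc i) * x ^ i) sums (1 / (1 - x)\<^sup>2)"
    using assms by (intro geometric_deriv_sums) auto
  moreover have "(\<lambda>i. 5 * x ^ i) sums (5 * (1 / (1 - x)))"
    using assms by (intro sums_mult geometric_sums) auto
  ultimately have "(\<lambda>i. of_nat (Suc i) * x ^ i - 5 * x ^ i) sums (1 / (1 - x)\<^sup>2 - 5 * (1 / (1 - x)))"
    by (rule sums_diff)
  then have "(\<lambda>i. (real i - 4) * x ^ i) sums (1 / (1 - x)\<^sup>2 - 5 / (1 - x))"
    by (simp add: algebra_simps)
  from sums_If_finite_set'[OF this, of "{..<N}" _ w] show ?thesis by simp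
qed

lemma weights_full:
  "\<exists>v. (\<forall>i. v i \<ge> 0) \<and> (\<forall>i\<ge>1. \<bar>real i - 4\<bar> * (16 / 25) ^ i \<le> v i)
     \<and> summable v \<and> suminf v \<le> 4 - 1 / 10"
proof -
  define w where "w i = (if i = 0 then 0 else \<bar>real i - 4\<bar> * (16 / 25) ^ i)" for i :: nat
  \<comment> \<open>From 5 on \<open>i - 4\<close> is positive, so here the weights are exact for
    all \<open>i \<ge> 1\<close>. Their sum is about 3.83, which leaves room for
    \<open>\<eta> = 1 / 10\<close> below \<open>\<kappa> = 4\<close>.\<close>
  define v where "v i = (if i < 5 then w i else (real i - 4) * (16 / 25) ^ i)" for i :: nat
  have s: "v sums (1 / (1 - 16 / 25)\<^sup>2 - 5 / (1 - 16 / 25) + (\<Sum>i<5. w i - (real i - 4) * (16 / 25) ^ i))"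
    unfolding v_def by (rule geometric_weight_sums) auto
  have "(\<Sum>i<5. w i - (real i - 4) * (16 / 25) ^ i) \<le> 4 - 1 / 10 - (1 / (1 - 16 / 25)\<^sup>2 - 5 / (1 - 16 / 25))"
    by (simp add: w_def lessThan_nat_numeral lessThan_Suc power_divide)
  then have "suminf v \<le> 4 - 1 / 10" unfolding sums_unique[OF s, symmetric] by simp
  then show ?thesis
    using s by (intro exI[of _ v]) (auto simp: v_def w_def sums_iff)
qed

text \<open>If the first differing digit has index \<open>n\<close>, not divisible by 3, the deleted relative indices
  are those congruent to \<open>c = - n\<close> modulo 3.\<close>

lemma weights_thinned:
  assumes c: "c = 1 \<or> c = 2"
  shows "\<exists>v. (\<forall>i. v i \<ge> 0) \<and> (\<forall>i\<ge>1. i mod 3 \<noteq> c \<longrightarrow> \<bar>real i - 4\<bar> * (177 / 250) ^ i \<le> v i)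
     \<and> summable v \<and> suminf v \<le> 4 - 1 / 10"
proof -
  define w where "w i = (if i = 0 \<or> i mod 3 = c then 0 else \<bar>real i - 4\<bar> * (177 / 250) ^ i)" for i :: nat
  define v where "v i = (if i < 15 then w i else (real i - 4) * (177 / 250) ^ i)" for i :: nat
  have s: "v sums (1 / (1 - 177 / 250)\<^sup>2 - 5 / (1 - 177 / 250) + (\<Sum>i<15. w i - (real i - 4) * (177 / 250) ^ i))"
    unfolding v_def by (rule geometric_weight_sums) auto
  have "(\<Sum>i<15. w i - (real i - 4) * (177 / 250) ^ i) \<le> 4 - 1 / 10 - (1 / (1 - 177 / 250)\<^sup>2 - 5 / (1 - 177 / 250))"
    using c by (elim disjE) (simp_all add: w_def lessThan_nat_numeral lessThan_Suc power_divide)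
  then have "suminf v \<le> 4 - 1 / 10" unfolding sums_unique[OF s, symmetric] by simp
  then show ?thesis
    using s by (intro exI[of _ v]) (auto simp: v_def w_def sums_iff)
qed

text \<open>Three consecutive integers contain two non-multiples of 3, so three steps contribute
  \<open>1 / 4\<close>, just below \<open>(63 / 100) ^ 3\<close>; the factor 2 covers
  \<open>n < 3\<close>.\<close>

lemma card_not_dvd_3:
  "(1 / 2 :: real) ^ card ({k. \<not> 3 dvd k} \<inter> {..<n}) \<le> 2 * (63 / 100) ^ n"
proof (induction n rule: less_induct)
  case (less n)
  show ?case
  proof (cases "n < 3")
    case True
    then consider "n = 0" | "n = 1" | "n = 2" by linarith
    then show ?thesis
    proof cases
      case 3
      have "{k. \<not> 3 dvd k} \<inter> {..<2} = {1::nat}" by (auto simp: less_2_cases_iff)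
      then show ?thesis using 3 by (simp add: power2_eq_square)
    next
      case 2
      have "{k. \<not> 3 dvd k} \<inter> {..<1} = ({}::nat set)" by auto
      then show ?thesis using 2 by simp
    qed simp
  next
    case False
    then obtain l where n: "n = l + 3" using le_iff_add[of 3 n] by (auto simp: add.commute)
    obtain a b where ab: "a \<noteq> b" "{k. \<not> 3 dvd k} \<inter> {l..<l+3} = {a, b}"
    proof -
      have l3: "{l..<l+3} = {l, l + 1, l + 2}" by auto
      consider "l mod 3 = 0" | "l mod 3 = 1" | "l mod 3 = 2" by linarith
      then show ?thesis
      proof cases
        case 1
        have "3 dvd l" "\<not> 3 dvd l + 1" "\<not> 3 dvd l + 2" using 1 by presburger+
        then have "{k. \<not> 3 dvd k} \<inter> {l..<l+3} = {l + 1, l + 2}" unfolding l3 by auto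
        then show ?thesis using that[of "l+1" "l+2"] by simp
      next
        case 2
        have "\<not> 3 dvd l" "\<not> 3 dvd l + 1" "3 dvd l + 2" using 2 by presburger+
        then have "{k. \<not> 3 dvd k} \<inter> {l..<l+3} = {l, l + 1}" unfolding l3 by auto
        then show ?thesis using that[of l "l+1"] by simp
      next
        case 3
        have "\<not> 3 dvd l" "3 dvd l + 1" "\<not> 3 dvd l + 2" using 3 by presburger+
        then have "{k. \<not> 3 dvd k} \<inter> {l..<l+3} = {l, l + 2}" unfolding l3 by auto
        then show ?thesis using that[of l "l+2"] by simp
      qed
    qed
    have "{k. \<not> 3 dvd k} \<inter> {..<n} = ({k. \<not> 3 dvd k} \<inter> {..<l}) \<union> ({k. \<not> 3 dvd k} \<inter> {l..<l+3})"
      by (auto simp: n)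
    moreover have "({k. \<not> 3 dvd k} \<inter> {..<l}) \<inter> ({k. \<not> 3 dvd k} \<inter> {l..<l+3}) = {}"
      by auto
    ultimately have "card ({k. \<not> 3 dvd k} \<inter> {..<n}) = card ({k. \<not> 3 dvd k} \<inter> {..<l}) + card ({k. \<not> 3 dvd k} \<inter> {l..<l+3})"
      using card_Un_disjoint[of "{k. \<not> 3 dvd k} \<inter> {..<l}" "{k. \<not> 3 dvd k} \<inter> {l..<l+3}"]
      by (metis finite_Int finite_lessThan finite_atLeastLessThan)
    also have "card ({k. \<not> 3 dvd k} \<inter> {l..<l+3}) = 2" using ab by simp
    finally have "(1 / 2 :: real) ^ card ({k. \<not> 3 dvd k} \<inter> {..<n}) = (1 / 2) ^ card ({k. \<not> 3 dvd k} \<inter> {..<l}) * (1 / 4)"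
      by (simp add: power_add power2_eq_square)
    also have "\<dots> \<le> (2 * (63 / 100) ^ l) * (63 / 100) ^ 3"
      using less.IH[of l] n by (intro mult_mono) (auto simp: power3_eq_cube)
    also have "\<dots> = 2 * (63 / 100) ^ n" by (simp add: n power_add)
    finally show ?thesis .
  qed
qed

subsection \<open>Random power series\<close>

text \<open>Besides independence, only the agreement bound is kept of the law of the digits, so the
  bias enters through the constant \<open>C\<close> alone. The digits are 0 or 1 at every point, not
  just almost surely.\<close>

locale random_digits = prob_space +
  fixes \<xi> :: "nat \<Rightarrow> 'a \<Rightarrow> real" and C :: real
  assumes indep: "indep_vars (\<lambda>_. borel) \<xi> {1..}"
    and digit: "\<And>k \<omega>. \<xi> k \<omega> = 0 \<or> \<xi> k \<omega> = 1"
    and C_nonneg: "C \<ge> 0"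
    and agree: "\<And>F. finite F \<Longrightarrow> F \<subseteq> {1..} \<Longrightarrow>
      emeasure (M \<Otimes>\<^sub>M M) {p \<in> space (M \<Otimes>\<^sub>M M). \<forall>k\<in>F. \<xi> k (fst p) = \<xi> k (snd p)}
        \<le> ennreal (C * (1 / 2) ^ card F)"
begin

lemma rv[measurable]: "k \<ge> 1 \<Longrightarrow> \<xi> k \<in> borel_measurable M"
  using indep by (simp add: indep_vars_def)

definition digit_sum :: "nat set \<Rightarrow> real \<Rightarrow> 'a \<Rightarrow> real" where
  "digit_sum T r \<omega> = (\<Sum>k. if k \<in> T then \<xi> k \<omega> * r ^ k else 0)"

lemma summable_digits:
  assumes "0 \<le> r" "r < 1"
  shows "summable (\<lambda>k. if k \<in> T then \<xi> k \<omega> * r ^ k else 0)"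
proof -
  have "\<bar>if k \<in> T then \<xi> k \<omega> else 0\<bar> \<le> 1" for k using digit[of k \<omega>] by auto
  then have "summable (\<lambda>k. (if k \<in> T then \<xi> k \<omega> else 0) * r ^ k)"
    using assms by (intro summable_bounded_coeff_power)
  then show ?thesis by (rule summable_cong[THEN iffD1, rotated]) simp
qed

lemma indep_var_digit_sum:
  assumes "A \<inter> B = {}" "A \<subseteq> {1..}" "B \<subseteq> {1..}"
  shows "indep_var borel (digit_sum A r) borel (digit_sum B r)"
proof -
  \<comment> \<open>\<open>f T\<close> reads only the coordinates in \<open>T\<close>, so
    restricting the digit family to \<open>T\<close> first changes nothing.\<close>
  define f where "f T x = (\<Sum>k. if k \<in> T then x k * r ^ k else 0)" for T and x :: "nat \<Rightarrow> real"
  have f[measurable]: "f T \<in> borel_measurable (Pi\<^sub>M T (\<lambda>_. borel))" for T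
    unfolding f_def
  proof (intro borel_measurable_suminf)
    show "(\<lambda>x. if k \<in> T then x k * r ^ k else 0) \<in> borel_measurable (Pi\<^sub>M T (\<lambda>_. borel))" for k
      by (cases "k \<in> T") auto
  qed
  have "indep_var borel (f A \<circ> (\<lambda>\<omega>. restrict (\<lambda>i. \<xi> i \<omega>) A)) borel (f B \<circ> (\<lambda>\<omega>. restrict (\<lambda>i. \<xi> i \<omega>) B))"
    by (rule indep_var_compose[OF indep_var_restrict[OF indep assms]]) measurable
  moreover have "f T \<circ> (\<lambda>\<omega>. restrict (\<lambda>i. \<xi> i \<omega>) T) = digit_sum T r" for T
    by (auto simp: f_def digit_sum_def fun_eq_iff intro!: suminf_cong)
  ultimately show ?thesis by simp
qed

lemma has_ac_distribution_digit_sum_superset: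
  assumes "has_ac_distribution M (digit_sum T r)" "T \<subseteq> {1..}" "0 \<le> r" "r < 1"
  shows "has_ac_distribution M (digit_sum {1..} r)"
proof -
  have "digit_sum {1..} r \<omega> = digit_sum ({1..} - T) r \<omega> + digit_sum T r \<omega>" for \<omega>
    unfolding digit_sum_def using assms
    by (subst suminf_add[OF summable_digits summable_digits]) (auto intro!: suminf_cong)
  then have "digit_sum {1..} r = (\<lambda>\<omega>. digit_sum ({1..} - T) r \<omega> + digit_sum T r \<omega>)" by blast
  moreover have "indep_var borel (digit_sum ({1..} - T) r) borel (digit_sum T r)"
    using assms(2) by (intro indep_var_digit_sum) auto
  ultimately show ?thesis using has_ac_distribution_add_indep assms(1) by metis
qed

text \<open>The digits with index \<open>m * k\<close>, \<open>k\<close> in \<open>T\<close>, form a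
  series in \<open>r ^ m\<close> to which the transversality criterion applies; the other digits are
  then added back. The bound on cardinalities turns agreement probabilities into
  \<open>2 * C * \<theta> ^ n\<close>.\<close>

lemma AE_digit_sum_scaled:
  assumes m: "m \<ge> 1" and T: "T \<subseteq> {1..}"
    and card: "\<And>n. (1 / 2) ^ card (T \<inter> {..<n}) \<le> 2 * \<theta> ^ n"
    and par: "0 < \<theta>" "\<theta> < a" "x < 1"
    and v: "\<And>n. n \<in> T \<Longrightarrow> \<exists>v. (\<forall>i. v i \<ge> 0) \<and> (\<forall>i\<ge>1. n + i \<in> T \<longrightarrow> \<bar>real i - 4\<bar> * x ^ i \<le> v i)
              \<and> summable v \<and> suminf v \<le> 4 - 1 / 10"
  shows "AE r in lborel. 0 \<le> r \<longrightarrow> a \<le> r ^ m \<longrightarrow> r ^ m \<le> x \<longrightarrow>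
    has_ac_distribution M (digit_sum {1..} r)"
proof -
  define X where "X k \<omega> = (if k \<in> T then \<xi> (m * k) \<omega> else 0)" for k \<omega>
  have mk: "m * k \<ge> 1" if "k \<in> T" for k using that T m by (auto simp: subset_iff)
  have "AE r in lborel. 0 \<le> r \<longrightarrow> a \<le> r ^ m \<longrightarrow> r ^ m \<le> x \<longrightarrow>
      has_ac_distribution M (\<lambda>\<omega>. \<Sum>k. X k \<omega> * (r ^ m) ^ k)"
  proof (rule AE_absolutely_continuous_of_transversality[where T = T and C = "2 * C" and \<kappa> = 4 and \<eta> = "1 / 10"])
    show "X k \<in> borel_measurable M" for k
    proof -
      have "X k = (if k \<in> T then \<xi> (m * k) else (\<lambda>_. 0))" by (auto simp: X_def fun_eq_iff)
      then show ?thesis using rv[OF mk[of k]] by auto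
    qed
    show "emeasure (M \<Otimes>\<^sub>M M) {p \<in> space (M \<Otimes>\<^sub>M M). \<forall>k<n. X k (fst p) = X k (snd p)} \<le> ennreal (2 * C * \<theta> ^ n)" for n
    proof -
      let ?F = "(*) m ` (T \<inter> {..<n})"
      have inj: "inj_on ((*) m) (T \<inter> {..<n})" using m by (auto simp: inj_on_def)
      have "{p \<in> space (M \<Otimes>\<^sub>M M). \<forall>k<n. X k (fst p) = X k (snd p)}
          = {p \<in> space (M \<Otimes>\<^sub>M M). \<forall>k\<in>?F. \<xi> k (fst p) = \<xi> k (snd p)}"
        by (auto simp: X_def)
      also have "emeasure (M \<Otimes>\<^sub>M M) \<dots> \<le> ennreal (C * (1 / 2) ^ card ?F)"
        using mk by (intro agree) auto
      also have "\<dots> \<le> ennreal (2 * C * \<theta> ^ n)"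
        unfolding card_image[OF inj] using mult_left_mono[OF card[of n] C_nonneg]
        by (intro ennreal_leI) (simp add: mult_ac)
      finally show ?thesis .
    qed
    show "X k \<omega> = 0 \<or> X k \<omega> = 1" for k \<omega> using digit by (simp add: X_def)
    show "X k \<omega> = 0" if "k \<notin> T" for k \<omega> using that by (simp add: X_def)
    show "prob_space M" by (rule prob_space_axioms)
  qed (use par m C_nonneg v in \<open>simp_all\<close>)
  then show ?thesis
  proof eventually_elim
    case (elim r)
    show ?case
    proof (intro impI)
      assume r: "0 \<le> r" "a \<le> r ^ m" "r ^ m \<le> x"
      have r1: "r < 1"
      proof (rule ccontr)
        assume "\<not> r < 1"
        then have "1 \<le> r ^ m" by (intro one_le_power) simp
        then show False using r(3) par by simp
      qed
      have "(\<Sum>k. X k \<omega> * (r ^ m) ^ k) = digit_sum ((*) m ` T) r \<omega>" for \<omega>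
      proof -
        let ?f = "\<lambda>j. if j \<in> (*) m ` T then \<xi> j \<omega> * r ^ j else 0"
        have "(\<Sum>k. ?f (m * k)) = suminf ?f"
          using m by (intro suminf_mono_reindex) (auto simp: strict_mono_def)
        moreover have "?f (m * k) = X k \<omega> * (r ^ m) ^ k" for k
          using m by (auto simp: X_def power_mult)
        ultimately show ?thesis by (simp add: digit_sum_def)
      qed
      then have "has_ac_distribution M (digit_sum ((*) m ` T) r)" using elim r by simp
      then show "has_ac_distribution M (digit_sum {1..} r)"
        by (rule has_ac_distribution_digit_sum_superset) (use mk r r1 in auto)
    qed
  qed
qed

lemma AE_digit_sum_full:
  assumes "m \<ge> 1" "1 / 2 < a"
  shows "AE r in lborel. 0 \<le> r \<longrightarrow> a \<le> r ^ m \<longrightarrow> r ^ m \<le> 16 / 25 \<longrightarrow>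
    has_ac_distribution M (digit_sum {1..} r)"
proof (rule AE_digit_sum_scaled[where T = "{1..}" and \<theta> = "1 / 2"])
  fix n :: nat
  \<comment> \<open>Index 0 carries no digit; the factor 2 pays for this one missing factor
    \<open>1 / 2\<close>.\<close>
  have "card ({1..} \<inter> {..<n}) = n - 1"
    by (metis atLeastLessThan_def card_atLeastLessThan)
  then show "(1 / 2 :: real) ^ card ({1..} \<inter> {..<n}) \<le> 2 * (1 / 2) ^ n"
    by (cases n) auto
next
  fix n :: nat
  show "\<exists>v. (\<forall>i. v i \<ge> 0) \<and> (\<forall>i\<ge>1. n + i \<in> {1..} \<longrightarrow> \<bar>real i - 4\<bar> * (16 / 25) ^ i \<le> v i)
              \<and> summable v \<and> suminf v \<le> 4 - 1 / 10"
    using weights_full by (elim ex_forward) blast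
qed (use assms in auto)

text \<open>Deleting every third digit raises \<open>\<theta>\<close> from \<open>1 / 2\<close> to
  \<open>63 / 100\<close>, still below \<open>16 / 25\<close>, so this range starts where that of
  the full digit set ends.\<close>

lemma AE_digit_sum_thinned:
  assumes "m \<ge> 1"
  shows "AE r in lborel. 0 \<le> r \<longrightarrow> 16 / 25 \<le> r ^ m \<longrightarrow> r ^ m \<le> 177 / 250 \<longrightarrow>
    has_ac_distribution M (digit_sum {1..} r)"
proof (rule AE_digit_sum_scaled[where T = "{k. \<not> 3 dvd k}" and \<theta> = "63 / 100"])
  fix n :: nat assume "n \<in> {k. \<not> 3 dvd k}"
  then have n: "n mod 3 \<noteq> 0" by (simp add: dvd_eq_mod_eq_0)
  define c where "c = 3 - n mod 3"
  have c: "c = 1 \<or> c = 2" using n unfolding c_def by presburger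
  have "n + i \<in> {k. \<not> 3 dvd k} \<longleftrightarrow> i mod 3 \<noteq> c" for i
    using n unfolding c_def mem_Collect_eq by presburger
  then show "\<exists>v. (\<forall>i. v i \<ge> 0) \<and> (\<forall>i\<ge>1. n + i \<in> {k. \<not> 3 dvd k} \<longrightarrow> \<bar>real i - 4\<bar> * (177 / 250) ^ i \<le> v i)
              \<and> summable v \<and> suminf v \<le> 4 - 1 / 10"
    using weights_thinned[OF c] by simp
next
  show "{k. \<not> 3 dvd k} \<subseteq> {1::nat..}"
    by (auto simp: Suc_le_eq intro!: gr0I)
next
  show "(1 / 2 :: real) ^ card ({k. \<not> 3 dvd k} \<inter> {..<n}) \<le> 2 * (63 / 100) ^ n" for n
    by (rule card_not_dvd_3)
qed (use assms in auto)

text \<open>Let \<open>j\<close> be the largest exponent with \<open>r ^ j > 1 / 2\<close>. Then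
  \<open>r ^ (2 * j) \<le> r ^ (j + 1) \<le> 1 / 2\<close>, so \<open>r ^ j\<close> is at most
  \<open>1 / sqrt 2\<close> and lies in one of the two ranges covered.\<close>

lemma AE_digit_sum:
  "AE r in lborel. r \<in> {1 / 2<..<1} \<longrightarrow> has_ac_distribution M (digit_sum {1..} r)"
proof -
  \<comment> \<open>The criterion for the full digit set asks for a lower end strictly above
    \<open>1 / 2\<close>. Countably many lower ends tending to \<open>1 / 2\<close> suffice, and
    their exceptional sets together are null.\<close>
  have "AE r in lborel. \<forall>m n. 0 \<le> r \<longrightarrow> 1 / 2 + 1 / real (Suc n) \<le> r ^ Suc m \<longrightarrow> r ^ Suc m \<le> 16 / 25 \<longrightarrow>
      has_ac_distribution M (digit_sum {1..} r)"
    unfolding AE_all_countable by (intro allI AE_digit_sum_full) auto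
  moreover have "AE r in lborel. \<forall>m. 0 \<le> r \<longrightarrow> 16 / 25 \<le> r ^ Suc m \<longrightarrow> r ^ Suc m \<le> 177 / 250 \<longrightarrow>
      has_ac_distribution M (digit_sum {1..} r)"
    unfolding AE_all_countable by (intro allI AE_digit_sum_thinned) auto
  ultimately show ?thesis
  proof eventually_elim
    case (elim r)
    show ?case
    proof
      assume r: "r \<in> {1 / 2<..<1}"
      have "\<exists>m. r ^ Suc m < 1 / 2"
      proof -
        obtain n where n: "r ^ n < 1 / 2" using r real_arch_pow_inv[of "1 / 2" r] by auto
        have "r ^ Suc n \<le> r ^ n" using r by (intro power_decreasing) auto
        then show ?thesis using n by (intro exI[of _ n]) simp
      qed
      \<comment> \<open>\<open>l\<close> itself is the exponent sought:
        \<open>r ^ Suc l \<le> 1 / 2 < r ^ l\<close>.\<close>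
      define l where "l = (LEAST m. r ^ Suc m \<le> 1 / 2)"
      have l1: "r ^ Suc l \<le> 1 / 2"
        unfolding l_def using \<open>\<exists>m. r ^ Suc m < 1 / 2\<close> by (metis (mono_tags, lifting) LeastI less_imp_le)
      have "l \<noteq> 0" using l1 r by (intro notI) simp
      then obtain m where lm: "l = Suc m" by (cases l) auto
      have m1: "1 / 2 < r ^ Suc m"
        using not_less_Least[of m "\<lambda>m. r ^ Suc m \<le> 1 / 2"] lm unfolding l_def[symmetric] by simp
      \<comment> \<open>The square of \<open>177 / 250\<close> is 0.501264, just above
        \<open>1 / 2\<close>.\<close>
      have m2: "r ^ Suc m \<le> 177 / 250"
      proof (rule ccontr)
        assume "\<not> ?thesis"
        then have "(177 / 250) * (177 / 250) \<le> r ^ Suc m * r ^ Suc m" by (intro mult_mono) auto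
        also have "\<dots> = r ^ (Suc m + Suc m)" by (rule power_add[symmetric])
        also have "\<dots> \<le> r ^ Suc l" unfolding lm using r by (intro power_decreasing) auto
        finally show False using l1 by simp
      qed
      show "has_ac_distribution M (digit_sum {1..} r)"
      proof (cases "r ^ Suc m \<le> 16 / 25")
        case True
        obtain n where "1 / real (Suc n) < r ^ Suc m - 1 / 2" using m1 nat_approx_posE[of "r ^ Suc m - 1 / 2"] by auto
        then have "1 / 2 + 1 / real (Suc n) \<le> r ^ Suc m" by simp
        then show ?thesis using elim(1) True r by (simp del: power_Suc of_nat_Suc) blast
      next
        case False
        then show ?thesis using elim(2) m2 r by (simp del: power_Suc) (metis less_imp_le linorder_not_le)
      qed
    qed
  qed
qed

end

text \<open>The digits are replaced by versions that are 0 or 1 at every point. Since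
  \<open>p0 k + p1 k = 1\<close>, these agree with the given ones almost surely, and so do the sums.
  The endpoint \<open>1 / 2\<close> is a null set of parameters.\<close>

theorem theorem7:
  fixes M :: "'a measure"
    and \<psi> :: "nat \<Rightarrow> 'a \<Rightarrow> real"
    and p0 p1 :: "nat \<Rightarrow> real"
  assumes "prob_space M"
    and "\<And>k. k \<ge> 1 \<Longrightarrow> p0 k \<ge> 0 \<and> p1 k \<ge> 0 \<and> p0 k + p1 k = 1"
    and "prob_space.indep_vars M (\<lambda>_. borel) \<psi> {1..}"
    and "\<And>k. k \<ge> 1 \<Longrightarrow> measure M {\<omega> \<in> space M. \<psi> k \<omega> = 0} = p0 k"
    and "\<And>k. k \<ge> 1 \<Longrightarrow> measure M {\<omega> \<in> space M. \<psi> k \<omega> = 1} = p1 k"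
    and "summable (\<lambda>k. (1 / 2 - p0 (Suc k))\<^sup>2)"
  shows "AE r in lborel. r \<in> {1 / 2..<1} \<longrightarrow> has_ac_distribution M (power_series_rv \<psi> r)"
proof -
  interpret prob_space M by fact
  have \<psi>m[measurable]: "\<psi> k \<in> borel_measurable M" if "k \<ge> 1" for k
    using assms(3) that by (simp add: indep_vars_def)
  \<comment> \<open>Values other than 0 and 1, which for \<open>k \<ge> 1\<close> form a null event,
    are sent to 0.\<close>
  define \<xi> where "\<xi> k \<omega> = (if \<psi> k \<omega> = 1 then 1 else 0 :: real)" for k \<omega>
  have ind: "indep_vars (\<lambda>_. borel) \<xi> {1..}"
    unfolding \<xi>_def by (rule indep_vars_compose2[OF assms(3)]) measurable
  have \<xi>_iff: "\<xi> k \<omega> = 1 \<longleftrightarrow> \<psi> k \<omega> = 1" "\<xi> k \<omega> = 0 \<longleftrightarrow> \<psi> k \<omega> \<noteq> 1" for k \<omega>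
    by (simp_all add: \<xi>_def)
  have P1: "prob {\<omega> \<in> space M. \<xi> k \<omega> = 1} = p1 k" if "k \<ge> 1" for k
    using assms(5)[OF that] by (simp only: \<xi>_iff)
  have P0: "prob {\<omega> \<in> space M. \<xi> k \<omega> = 0} = p0 k" if "k \<ge> 1" for k
  proof -
    note [measurable] = \<psi>m[OF that]
    have "prob {\<omega> \<in> space M. \<xi> k \<omega> = 0} = 1 - prob {\<omega> \<in> space M. \<psi> k \<omega> = 1}"
      unfolding \<xi>_iff by (subst prob_neg[symmetric]) auto
    then show ?thesis using assms(5)[OF that] assms(2)[OF that] by simp
  qed
  interpret random_digits M \<xi> "exp (4 * (\<Sum>k. (1 / 2 - p0 (Suc k))\<^sup>2))"
  proof
    fix F :: "nat set" assume F: "finite F" "F \<subseteq> {1..}"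
    have "emeasure (M \<Otimes>\<^sub>M M) {p \<in> space (M \<Otimes>\<^sub>M M). \<forall>k\<in>F. \<xi> k (fst p) = \<xi> k (snd p)}
        = ennreal (\<Prod>k\<in>F. (prob {\<omega> \<in> space M. \<xi> k \<omega> = 0})\<^sup>2 + (prob {\<omega> \<in> space M. \<xi> k \<omega> = 1})\<^sup>2)"
      by (rule emeasure_pair_agree[OF ind F]) (simp add: \<xi>_def)
    also have "\<dots> = ennreal (\<Prod>k\<in>F. (p0 k)\<^sup>2 + (p1 k)\<^sup>2)"
      using F by (intro arg_cong[where f = ennreal] prod.cong) (auto simp: P0 P1 subset_iff)
    also have "\<dots> \<le> ennreal (exp (4 * (\<Sum>k. (1 / 2 - p0 (Suc k))\<^sup>2)) * (1 / 2) ^ card F)"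
      using assms(2,6) F by (intro ennreal_leI prod_square_sum_le) auto
    finally show "emeasure (M \<Otimes>\<^sub>M M) {p \<in> space (M \<Otimes>\<^sub>M M). \<forall>k\<in>F. \<xi> k (fst p) = \<xi> k (snd p)}
      \<le> ennreal (exp (4 * (\<Sum>k. (1 / 2 - p0 (Suc k))\<^sup>2)) * (1 / 2) ^ card F)" .
  qed (use ind in \<open>auto simp: \<xi>_def\<close>)
  have "AE \<omega> in M. \<psi> (Suc k) \<omega> = \<xi> (Suc k) \<omega>" for k
  proof -
    have "prob {\<omega> \<in> space M. \<psi> (Suc k) \<omega> = 0 \<or> \<psi> (Suc k) \<omega> = 1}
        = prob ({\<omega> \<in> space M. \<psi> (Suc k) \<omega> = 0} \<union> {\<omega> \<in> space M. \<psi> (Suc k) \<omega> = 1})"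
      by (intro arg_cong[where f = prob]) auto
    also have "\<dots> = p0 (Suc k) + p1 (Suc k)"
      by (subst finite_measure_Union) (auto simp: assms(4,5))
    finally have "prob {\<omega> \<in> space M. \<psi> (Suc k) \<omega> = 0 \<or> \<psi> (Suc k) \<omega> = 1} = 1"
      using assms(2)[of "Suc k"] by simp
    then have "AE \<omega> in M. \<psi> (Suc k) \<omega> = 0 \<or> \<psi> (Suc k) \<omega> = 1"
      by (subst prob_Collect_eq_1[symmetric]) auto
    then show ?thesis by eventually_elim (auto simp: \<xi>_def)
  qed
  then have eq: "AE \<omega> in M. \<forall>k. \<psi> (Suc k) \<omega> = \<xi> (Suc k) \<omega>" by (simp add: AE_all_countable)
  have "AE r in lborel. r \<noteq> (1 / 2 :: real)" by (rule AE_lborel_singleton)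
  with AE_digit_sum show ?thesis
  proof eventually_elim
    case (elim r)
    show ?case
    proof
      assume "r \<in> {1 / 2..<1}"
      then have r: "1 / 2 < r" "r < 1" using elim(2) by auto
      show "has_ac_distribution M (power_series_rv \<psi> r)"
      proof (rule has_ac_distribution_cong_AE)
        show "has_ac_distribution M (digit_sum {1..} r)" using elim(1) r by simp
        show "power_series_rv \<psi> r \<in> borel_measurable M"
          unfolding power_series_rv_def by measurable
        from eq show "AE \<omega> in M. power_series_rv \<psi> r \<omega> = digit_sum {1..} r \<omega>"
        proof eventually_elim
          case (elim \<omega>)
          \<comment> \<open>Index 0 lies outside \<open>{1..}\<close>, so the split-off first term
            vanishes and the shifted series remains.\<close>
          have "digit_sum {1..} r \<omega> = (\<Sum>k. \<xi> (Suc k) \<omega> * r ^ Suc k)"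
            using suminf_split_head[OF summable_digits[of r "{1..}" \<omega>]] r
            by (simp add: digit_sum_def)
          then show ?case using elim by (simp add: power_series_rv_def)
        qed
      qed
    qed
  qed
qed

end
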